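(* For all integers $n,k\ge1$, as formal Laurent series in $q$, \[ \sum_{\pi\in \mathrm{RPP}(\delta_{n+2k}/\delta_n)} q^{|\pi|} =q^{-\frac{k(k-1)(6n+8k-1)}{6}} \det\left( \frac{E^*_{2n+2i+2j-3}(q)}{(q;q)_{2n+2i+2j-3}} \right)_{i,j=1}^k . \]
   Context: For $n\ge1$, $\delta_n=(n-1,n-2,\dots,1)$ is the staircase partition ($\delta_1=\emptyset$). For partitions $\mu\subset\lambda$, the skew shape $\lambda/\mu$ is the set difference of Young diagrams. A reverse plane partition (RPP) of shape $\lambda/\mu$ is a filling of the squares of $\lambda/\mu$ with nonnegative integers that is weakly increasing along each row (left to right) and each column (top to bottom); $\mathrm{RPP}(\lambda/\mu)$ is the set of these, and $|\pi|$ is the sum of the entries of $\pi$. $(a;q)_m=(1-a)(1-aq)\cdots(1-aq^{m-1})$. $\mathfrak S_m$ is the set of permutations of $\{1,\dots,m\}$, written also as words $\pi_1\pi_2\cdots\pi_m$ with $\pi_i=\pi(i)$; products are compositions, $\pi\sigma(i)=\pi(\sigma(i))$. $\mathrm{Alt}_m$ is the set of alternating permutations $\pi\in \mathfrak S_m$, i.e. $\pi_1<\pi_2>\pi_3<\pi_4>\cdots$. For a word $w=w_1\cdots w_m$, $\mathrm{maj}(w)$ is the sum of all $i\in\{1,\dots,m-1\}$ with $w_i>w_{i+1}$. $\kappa_m\in \mathfrak S_m$ is the permutation with cycle notation $(1)(2,3)(4,5)\cdots(2\lfloor (m-1)/2\rfloor,\,2\lfloor (m-1)/2\rfloor+1)$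 (all remaining elements fixed). The $q$-Euler number is \[ E^*_m(q)=\sum_{\pi\in\mathrm{Alt}_m}q^{\mathrm{maj}(\kappa_m\pi^{-1})}. \] *)

theory Defs
  imports
    "HOL-Combinatorics.Permutations"
    "HOL-Computational_Algebra.Formal_Laurent_Series"
    "Jordan_Normal_Form.Determinant"
begin

section \<open>Skew shapes and reverse plane partitions\<close>

text \<open>A partition is the list of its parts. Squares are pairs (row, column), counted from 0.\<close>

definition young_diagram :: "nat list \<Rightarrow> (nat \<times> nat) set" where
  "young_diagram lam = {(i, j). i < length lam \<and> j < lam ! i}"

definition skew_shape :: "nat list \<Rightarrow> nat list \<Rightarrow> (nat \<times> nat) set" where
  "skew_shape lam mu = young_diagram lam - young_diagram mu"

definition staircase :: "nat \<Rightarrow> nat list" where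
  "staircase n = rev [1..<n]"

text \<open>Fillings are extensional functions on the shape, so that distinct functions
  are distinct fillings.\<close>

definition RPP :: "(nat \<times> nat) set \<Rightarrow> (nat \<times> nat \<Rightarrow> nat) set" where
  "RPP S = {p \<in> S \<rightarrow>\<^sub>E UNIV.
     (\<forall>i j j'. (i, j) \<in> S \<longrightarrow> (i, j') \<in> S \<longrightarrow> j \<le> j' \<longrightarrow> p (i, j) \<le> p (i, j')) \<and>
     (\<forall>i i' j. (i, j) \<in> S \<longrightarrow> (i', j) \<in> S \<longrightarrow> i \<le> i' \<longrightarrow> p (i, j) \<le> p (i', j))}"

text \<open>The formal sum of \<open>q ^ |p|\<close> over all reverse plane partitions \<open>p\<close> of shape \<open>S\<close>. For finite
  \<open>S\<close> the cardinalities are genuine ones, by \<open>finite_RPP_size\<close> below.\<close>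

definition RPP_series :: "(nat \<times> nat) set \<Rightarrow> rat fps" where
  "RPP_series S = Abs_fps (\<lambda>N. of_nat (card {p \<in> RPP S. (\<Sum>c\<in>S. p c) = N}))"

lemma finite_skew_shape: "finite (skew_shape lam mu)"
proof -
  have "young_diagram lam = (SIGMA i:{..<length lam}. {..<lam ! i})"
    by (auto simp: young_diagram_def)
  then have "finite (young_diagram lam)" by simp
  then show ?thesis by (simp add: skew_shape_def)
qed

lemma finite_RPP_size:
  assumes "finite S"
  shows "finite {p \<in> RPP S. (\<Sum>c\<in>S. p c) = N}"
proof (rule finite_subset)
  show "{p \<in> RPP S. (\<Sum>c\<in>S. p c) = N} \<subseteq> S \<rightarrow>\<^sub>E {..N}"
    using assms by (auto simp: RPP_def PiE_iff extensional_def intro: member_le_sum)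
  show "finite (S \<rightarrow>\<^sub>E {..N})"
    using assms by (simp add: finite_PiE)
qed


section \<open>The \<open>q\<close>-Euler numbers\<close>

definition q_pochhammer :: "'a::comm_ring_1 \<Rightarrow> 'a \<Rightarrow> nat \<Rightarrow> 'a" where
  "q_pochhammer a q m = (\<Prod>i<m. 1 - a * q ^ i)"

definition alternating_perms :: "nat \<Rightarrow> (nat \<Rightarrow> nat) set" where
  "alternating_perms m = {p. p permutes {1..m} \<and>
     (\<forall>i\<in>{1..<m}. if odd i then p i < p (Suc i) else p i > p (Suc i))}"

text \<open>The letters \<open>w\<^sub>i\<close> of a word are \<open>w ! (i - 1)\<close>.\<close>

definition maj :: "nat list \<Rightarrow> nat" where
  "maj w = (\<Sum>i | 1 \<le> i \<and> i < length w \<and> w ! (i - 1) > w ! i. i)"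

definition perm_word :: "nat \<Rightarrow> (nat \<Rightarrow> nat) \<Rightarrow> nat list" where
  "perm_word m p = map p [1..<Suc m]"

definition kappa :: "nat \<Rightarrow> nat \<Rightarrow> nat" where
  "kappa m i = (if 2 \<le> i \<and> i \<le> 2 * ((m - 1) div 2) + 1
                then if even i then i + 1 else i - 1
                else i)"

text \<open>\<open>inv_into UNIV p\<close> is the inverse permutation; \<open>inv\<close> itself is taken by HOL-Algebra.\<close>

definition q_Euler :: "nat \<Rightarrow> 'a::comm_ring_1 \<Rightarrow> 'a" where
  "q_Euler m q = (\<Sum>p\<in>alternating_perms m. q ^ maj (perm_word m (kappa m \<circ> inv_into UNIV p)))"


text \<open>The division by 6 in the exponent of \<open>q\<close> is exact.\<close>

lemma six_dvd_exponent:
  fixes n k :: int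
  shows "6 dvd k * (k - 1) * (6 * n + 8 * k - 1)"
proof -
  have "2 dvd k * (k - 1)" by simp
  moreover have "3 dvd k * (k - 1) * (8 * k - 1)"
  proof -
    have "k mod 3 = 0 \<or> k mod 3 = 1 \<or> k mod 3 = 2" by presburger
    then have "3 dvd k \<or> 3 dvd k - 1 \<or> 3 dvd 8 * k - 1" by presburger
    then show ?thesis by auto
  qed
  ultimately obtain a b where a: "k * (k - 1) = 2 * a" and b: "k * (k - 1) * (8 * k - 1) = 3 * b"
    unfolding dvd_def by blast
  have "2 * (a * (8 * k - 1)) = 3 * b" using a b by (simp add: mult.assoc)
  moreover have "\<exists>c. x = 3 * c" if "2 * x = 3 * b" for x :: int
    using that by presburger
  ultimately obtain c where "a * (8 * k - 1) = 3 * c" by blast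
  then have "k * (k - 1) * (6 * n + 8 * k - 1) = 6 * (2 * a * n + c)"
    using a by (simp add: algebra_simps)
  then show ?thesis by simp
qed

end

theory Submission
  imports Defs
begin

text \<open>
  The proof reads a reverse plane partition along the diagonals of its shape and sees in it \<open>k\<close>
  non-intersecting lattice paths, whose generating function is a determinant.

  The antidiagonals of the shape \<open>\<delta>\<^sub>n\<^sub>+\<^sub>2\<^sub>k / \<delta>\<^sub>n\<close> number \<open>2 k\<close>. Taken two at a time they cut it
  into \<open>k\<close> nested zigzag strips, strip \<open>r\<close> (from \<open>0\<close>, the innermost) having \<open>2 n + 4 r + 1\<close> cells.
  Adding \<open>r\<close> to all entries of strip \<open>r\<close> makes the inequalities between neighbouring strips strict.
  On every diagonal the new entries then increase strictly from strip to strip, and on adjacent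
  diagonals they interlace. Conversely the shift can be undone: every cell of strip \<open>r + 1\<close> lies
  weakly below and to the right of a cell of strip \<open>r\<close>, so in an interlacing configuration strictness
  makes all entries of strip \<open>r\<close> at least \<open>r\<close>. The shift increases the size by \<open>\<Sum>r<k. r (2 n + 4 r + 1)\<close>, which is
  the exponent \<open>k (k - 1) (6 n + 8 k - 1) / 6\<close> of the theorem.

  Interlacing configurations can be summed diagonal by diagonal. Given the configuration on one
  diagonal, the entries on the preceding diagonal range over a product of disjoint intervals. If the
  sum over everything to the left is \<open>det (f\<^sub>i (x\<^sub>j))\<close>, then multilinearity turns the sum over the
  intervals into a determinant whose rows are differences of adjacent values of the partial sums of
  the \<open>f\<^sub>i\<close>, and row operations remove the differences: the result is \<open>det (F\<^sub>i (y\<^sub>j))\<close>, where \<open>F\<^sub>i\<close>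
  comes from \<open>f\<^sub>i\<close> by one step of a single unconstrained path. (This is the
  Lindstrom-Gessel-Viennot argument with row operations in place of an involution.) In the end the
  \<open>(i, j)\<close> entry counts single zigzag paths that enter where strip \<open>i\<close> begins and leave where strip
  \<open>j\<close> ends; these have \<open>2 (n + i + j) + 1\<close> entries. The argument is carried out with all entries
  bounded by some \<open>M\<close>, so that all sums are finite; coefficients of \<open>q\<^sup>N\<close> do not depend on \<open>M\<close> once \<open>M\<close>
  is large (\<open>shifted_RPP_series\<close>).

  It remains to count single zigzags of odd length \<open>m\<close>. These are the \<open>P\<close>-partitions of the zigzag
  poset, and \<open>\<kappa>\<^sub>m\<close> is a natural labelling of that poset. Sorting the positions of a zigzag by
  decreasing value, and by increasing label among equal values, splits the set of zigzags into one
  class for each alternating permutation \<open>\<pi>\<close>. The class of \<open>\<pi>\<close> consists of weakly decreasing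
  sequences that have to decrease strictly at the descents of \<open>\<kappa>\<^sub>m \<pi>\<^sup>-\<^sup>1\<close>, whence its generating
  function \<open>q^maj(\<kappa>\<^sub>m \<pi>\<^sup>-\<^sup>1) / (q; q)\<^sub>m\<close> (\<open>size_series_zigzags\<close>).
\<close>

section \<open>Row operations and sums in determinants\<close>

abbreviation (input) fdet :: "nat \<Rightarrow> (nat \<Rightarrow> nat \<Rightarrow> 'a::comm_ring_1) \<Rightarrow> 'a" where
  "fdet k A \<equiv> det (mat k k (\<lambda>(j, i). A j i))"

lemma fdet_leibniz:
  "fdet k A = (\<Sum>p | p permutes {..<k}. signof p * (\<Prod>j<k. A j (p j)))"
proof -
  have "fdet k A = (\<Sum>p | p permutes {0..<k}. signof p * (\<Prod>j=0..<k. mat k k (\<lambda>(j, i). A j i) $$ (j, p j)))"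
    by (subst det_def') auto
  also have "\<dots> = (\<Sum>p | p permutes {0..<k}. signof p * (\<Prod>j=0..<k. A j (p j)))"
    by (intro sum.cong prod.cong arg_cong2[where f="(*)"] refl)
       (auto dest: permutes_in_image)
  finally show ?thesis
    by (simp add: atLeast0LessThan)
qed

lemma fdet_cong:
  "(\<And>j i. j < k \<Longrightarrow> i < k \<Longrightarrow> A j i = B j i) \<Longrightarrow> fdet k A = fdet k B"
  by (intro arg_cong[where f=det] eq_matI) auto

lemma fdet_scale_rows:
  "fdet k (\<lambda>j i. c j * A j i) = (\<Prod>j<k. c j) * fdet k A"
  by (simp add: fdet_leibniz prod.distrib sum_distrib_left mult_ac)

text \<open>Multilinearity: the choices made in different rows are independent of each other, so the set over
  which the determinants are summed is a product set. Rows outside \<open>J\<close> are left as they are.\<close>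

lemma fdet_sum_rows:
  assumes J: "J \<subseteq> {..<k}" and fin: "\<And>j. j \<in> J \<Longrightarrow> finite (S j)"
  shows "fdet k (\<lambda>j i. if j \<in> J then \<Sum>x\<in>S j. g j x i else u j i) =
    (\<Sum>x\<in>PiE J S. fdet k (\<lambda>j i. if j \<in> J then g j (x j) i else u j i))"
proof -
  have finJ: "finite J" using J finite_subset by blast
  have split: "(\<Prod>j<k. if j \<in> J then a j else b j) = (\<Prod>j\<in>J. a j) * (\<Prod>j\<in>{..<k} - J. b j)"
    for a b :: "nat \<Rightarrow> 'b::comm_ring_1"
  proof -
    have "(\<Prod>j<k. if j \<in> J then a j else b j) =
        (\<Prod>j\<in>{..<k} - J. if j \<in> J then a j else b j) * (\<Prod>j\<in>J. if j \<in> J then a j else b j)"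
      by (rule prod.subset_diff[OF J]) simp
    then show ?thesis by (simp add: mult.commute)
  qed
  have "(\<Prod>j\<in>J. \<Sum>x\<in>S j. g j x (p j)) = (\<Sum>x\<in>PiE J S. \<Prod>j\<in>J. g j (x j) (p j))" for p
    by (rule prod_sum_PiE) (use finJ fin in auto)
  then show ?thesis
    unfolding fdet_leibniz split
    by (simp add: sum_distrib_left sum_distrib_right sum.swap[of _ _ "PiE J S"])
qed

text \<open>The new matrix is the product of a unitriangular matrix and the old one. All rows selected by \<open>P\<close>
  are changed simultaneously, each by the \<^emph>\<open>old\<close> neighbouring row.\<close>

lemma fdet_subtract_next_row:
  "fdet k (\<lambda>j i. if P j \<and> Suc j < k then A j i - A (Suc j) i else A j i) = fdet k A"
proof -
  define L where "L = mat k k (\<lambda>(j, l). if l = j then 1 else if l = Suc j \<and> P j then - 1 else (0::'a))"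
  have L: "L \<in> carrier_mat k k" by (simp add: L_def)
  have "det L = 1"
  proof -
    have "upper_triangular L" by (auto simp: upper_triangular_def L_def)
    then have "det L = prod_list (diag_mat L)" using L by (rule det_upper_triangular)
    also have "diag_mat L = replicate k 1"
      by (auto simp: diag_mat_def L_def intro!: nth_equalityI)
    finally show ?thesis by simp
  qed
  moreover have "L * mat k k (\<lambda>(j, i). A j i) =
      mat k k (\<lambda>(j, i). if P j \<and> Suc j < k then A j i - A (Suc j) i else A j i)"
  proof (rule eq_matI)
    fix j i assume ji: "j < dim_row (mat k k (\<lambda>(j, i). if P j \<and> Suc j < k then A j i - A (Suc j) i else A j i))"
      "i < dim_col (mat k k (\<lambda>(j, i). if P j \<and> Suc j < k then A j i - A (Suc j) i else A j i))"
    then have ji: "j < k" "i < k" by auto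
    have "(L * mat k k (\<lambda>(j, i). A j i)) $$ (j, i) =
        (\<Sum>l<k. (if l = j then 1 else if l = Suc j \<and> P j then - 1 else 0) * A l i)"
      using ji by (auto simp: L_def scalar_prod_def atLeast0LessThan intro!: sum.cong)
    also have "\<dots> = (\<Sum>l<k. (if l = j then A l i else 0) + (if l = Suc j then (if P j then - A l i else 0) else 0))"
      by (rule sum.cong) auto
    also have "\<dots> = (if P j \<and> Suc j < k then A j i - A (Suc j) i else A j i)"
      using ji by (simp add: sum.distrib)
    finally show "(L * mat k k (\<lambda>(j, i). A j i)) $$ (j, i) =
        mat k k (\<lambda>(j, i). if P j \<and> Suc j < k then A j i - A (Suc j) i else A j i) $$ (j, i)"
      using ji by simp
  qed (auto simp: L_def)
  ultimately show ?thesis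
    using det_mult[OF L, of "mat k k (\<lambda>(j, i). A j i)"] by simp
qed

lemma fdet_subtract_previous_row:
  "fdet k (\<lambda>j i. if P j \<and> 0 < j then A j i - A (j - 1) i else A j i) = fdet k A"
proof -
  define L where "L = mat k k (\<lambda>(j, l). if l = j then 1 else if Suc l = j \<and> P j then - 1 else (0::'a))"
  have L: "L \<in> carrier_mat k k" by (simp add: L_def)
  have "det L = 1"
  proof -
    have "det L = prod_list (diag_mat L)" 
      by (rule det_lower_triangular[OF _ L]) (auto simp: L_def)
    also have "diag_mat L = replicate k 1"
      by (auto simp: diag_mat_def L_def intro!: nth_equalityI)
    finally show ?thesis by simp
  qed
  moreover have "L * mat k k (\<lambda>(j, i). A j i) =
      mat k k (\<lambda>(j, i). if P j \<and> 0 < j then A j i - A (j - 1) i else A j i)"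
  proof (rule eq_matI)
    fix j i assume ji: "j < dim_row (mat k k (\<lambda>(j, i). if P j \<and> 0 < j then A j i - A (j - 1) i else A j i))"
      "i < dim_col (mat k k (\<lambda>(j, i). if P j \<and> 0 < j then A j i - A (j - 1) i else A j i))"
    then have ji: "j < k" "i < k" by auto
    have "(L * mat k k (\<lambda>(j, i). A j i)) $$ (j, i) =
        (\<Sum>l<k. (if l = j then 1 else if Suc l = j \<and> P j then - 1 else 0) * A l i)"
      using ji by (auto simp: L_def scalar_prod_def atLeast0LessThan intro!: sum.cong)
    also have "\<dots> = (\<Sum>l<k. (if l = j then A l i else 0) + (if l = j - 1 then (if P j \<and> 0 < j then - A l i else 0) else 0))"
      by (rule sum.cong) auto
    also have "\<dots> = (if P j \<and> 0 < j then A j i - A (j - 1) i else A j i)"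
      using ji by (auto simp: sum.distrib)
    finally show "(L * mat k k (\<lambda>(j, i). A j i)) $$ (j, i) =
        mat k k (\<lambda>(j, i). if P j \<and> 0 < j then A j i - A (j - 1) i else A j i) $$ (j, i)"
      using ji by simp
  qed (auto simp: L_def)
  ultimately show ?thesis
    using det_mult[OF L, of "mat k k (\<lambda>(j, i). A j i)"] by simp
qed

text \<open>In the Leibniz expansion only permutations fixing \<open>r\<close> contribute, because column \<open>r\<close> vanishes off
  the diagonal, and these take only the diagonal entry from row \<open>r\<close>.\<close>

lemma fdet_row_with_lonely_column:
  assumes r: "r < k"
    and col: "\<And>j. j < k \<Longrightarrow> j \<noteq> r \<Longrightarrow> A j r = 0"
    and rows: "\<And>j i. j < k \<Longrightarrow> j \<noteq> r \<Longrightarrow> i < k \<Longrightarrow> A j i = B j i"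
    and corner: "A r r = B r r"
  shows "fdet k A = fdet k B"
  unfolding fdet_leibniz
proof (intro sum.cong refl arg_cong2[where f="(*)"])
  fix p assume "p \<in> {p. p permutes {..<k}}"
  then have p: "p permutes {..<k}" by simp
  show "(\<Prod>j<k. A j (p j)) = (\<Prod>j<k. B j (p j))"
  proof (cases "p r = r")
    case True
    then show ?thesis
      using rows corner permutes_in_image[OF p] by (intro prod.cong) (metis lessThan_iff)+
  next
    case False
    obtain j where j: "p j = r" "j < k"
      using permutes_surj[OF p] r permutes_in_image[OF p] by (metis lessThan_iff surjD)
    with False have "j \<noteq> r" by auto
    then have "A j (p j) = 0" "B j (p j) = 0" using col[of j] rows[of j r] j r by auto
    then show ?thesis using j by (metis finite_lessThan lessThan_iff prod_zero)
  qed
qed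

section \<open>Sums over walks\<close>

text \<open>The transfer matrix method. At time \<open>t\<close> a walk is in a state of \<open>C t\<close>, its steps obey \<open>R\<close>, and it
  collects a weight \<open>W\<close> at every time, the initial and the final time included.\<close>

primrec walk_sum ::
  "(nat \<Rightarrow> 'b set) \<Rightarrow> (nat \<Rightarrow> 'b \<Rightarrow> 'b \<Rightarrow> bool) \<Rightarrow> (nat \<Rightarrow> 'b \<Rightarrow> 'a::comm_semiring_1) \<Rightarrow> nat \<Rightarrow> 'b \<Rightarrow> 'a"
where
  "walk_sum C R W 0 y = W 0 y"
| "walk_sum C R W (Suc t) y = W (Suc t) y * (\<Sum>x | x \<in> C t \<and> R t x y. walk_sum C R W t x)"

definition walks :: "(nat \<Rightarrow> 'b set) \<Rightarrow> (nat \<Rightarrow> 'b \<Rightarrow> 'b \<Rightarrow> bool) \<Rightarrow> nat \<Rightarrow> (nat \<Rightarrow> 'b) set" where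
  "walks C R t = {b \<in> PiE {..t} C. \<forall>s<t. R s (b s) (b (Suc s))}"

lemma finite_walks:
  assumes "\<And>t. finite (C t)"
  shows "finite (walks C R t)"
  using finite_PiE[of "{..t}" C] assms by (simp add: walks_def)

lemma walk_sum_eq_sum_walks_to:
  assumes fin: "\<And>t. finite (C t)" and "y \<in> C t"
  shows "walk_sum C R W t y = (\<Sum>b | b \<in> walks C R t \<and> b t = y. \<Prod>s\<le>t. W s (b s))"
  using \<open>y \<in> C t\<close>
proof (induction t arbitrary: y)
  case 0
  have "{b \<in> walks C R 0. b 0 = y} = {\<lambda>s\<in>{0}. y}"
    using 0 by (fastforce simp: walks_def fun_eq_iff PiE_iff extensional_def)
  then show ?case by simp
next
  case (Suc t)
  define X where "X = {x \<in> C t. R t x y}"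
  define B where "B x = {b \<in> walks C R t. b t = x}" for x
  have finX: "finite X" using fin by (simp add: X_def)
  have finB: "finite (B x)" for x using finite_walks[OF fin] by (simp add: B_def)
  have "walk_sum C R W (Suc t) y = W (Suc t) y * (\<Sum>x\<in>X. \<Sum>b\<in>B x. \<Prod>s\<le>t. W s (b s))"
    using Suc.IH by (simp add: X_def B_def)
  also have "(\<Sum>x\<in>X. \<Sum>b\<in>B x. \<Prod>s\<le>t. W s (b s)) = (\<Sum>b\<in>(\<Union>x\<in>X. B x). \<Prod>s\<le>t. W s (b s))"
    using finX finB by (intro sum.UNION_disjoint[symmetric]) (auto simp: B_def)
  also have "W (Suc t) y * \<dots> = (\<Sum>b\<in>(\<Union>x\<in>X. B x). W (Suc t) y * (\<Prod>s\<le>t. W s (b s)))"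
    by (rule sum_distrib_left)
  also have "\<dots> = (\<Sum>b | b \<in> walks C R (Suc t) \<and> b (Suc t) = y. \<Prod>s\<le>Suc t. W s (b s))"
  proof (rule sum.reindex_bij_witness[where i = "\<lambda>b. b(Suc t := undefined)" and j = "\<lambda>b. b(Suc t := y)"])
    fix b assume b: "b \<in> (\<Union>x\<in>X. B x)"
    then have bE: "b \<in> PiE {..t} C" and bR: "\<forall>s<t. R s (b s) (b (Suc s))" and "R t (b t) y"
      by (auto simp: B_def walks_def X_def)
    have und: "b (Suc t) = undefined" using PiE_arb[OF bE] by simp
    then show "(b(Suc t := y))(Suc t := undefined) = b" by auto
    have "b(Suc t := y) \<in> PiE {..Suc t} C"
      using PiE_fun_upd[OF Suc.prems bE] by (simp add: atMost_Suc)
    with bR \<open>R t (b t) y\<close> show "b(Suc t := y) \<in> {b \<in> walks C R (Suc t). b (Suc t) = y}"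
      by (auto simp: walks_def less_Suc_eq)
    have "(\<Prod>s\<le>t. W s ((b(Suc t := y)) s)) = (\<Prod>s\<le>t. W s (b s))"
      by (rule prod.cong) auto
    then show "(\<Prod>s\<le>Suc t. W s ((b(Suc t := y)) s)) = W (Suc t) y * (\<Prod>s\<le>t. W s (b s))"
      by (simp add: mult.commute)
  next
    fix b assume "b \<in> {b \<in> walks C R (Suc t). b (Suc t) = y}"
    then have bE: "b \<in> PiE {..Suc t} C" and bR: "\<forall>s<Suc t. R s (b s) (b (Suc s))" and y: "b (Suc t) = y"
      by (auto simp: walks_def)
    show "(b(Suc t := undefined))(Suc t := y) = b" using y by auto
    have "b(Suc t := undefined) \<in> PiE {..t} C"
      using bE by (intro fun_upd_in_PiE) (auto simp: atMost_Suc)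
    moreover have "b t \<in> C t" "R t (b t) y" using bE bR y by auto
    ultimately show "b(Suc t := undefined) \<in> (\<Union>x\<in>X. B x)"
      using bR by (auto simp: B_def X_def walks_def)
  qed
  finally show ?case .
qed

lemma sum_walks_eq_walk_sum:
  assumes fin: "\<And>t. finite (C t)"
  shows "(\<Sum>b\<in>walks C R t. \<Prod>s\<le>t. W s (b s)) = (\<Sum>y\<in>C t. walk_sum C R W t y)"
proof -
  have "walks C R t = (\<Union>y\<in>C t. {b \<in> walks C R t. b t = y})"
    by (auto simp: walks_def)
  then have "(\<Sum>b\<in>walks C R t. \<Prod>s\<le>t. W s (b s)) =
      (\<Sum>b\<in>(\<Union>y\<in>C t. {b \<in> walks C R t. b t = y}). \<Prod>s\<le>t. W s (b s))"
    by simp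
  also have "\<dots> = (\<Sum>y\<in>C t. \<Sum>b | b \<in> walks C R t \<and> b t = y. \<Prod>s\<le>t. W s (b s))"
    using fin finite_walks[OF fin] by (intro sum.UNION_disjoint) auto
  also have "\<dots> = (\<Sum>y\<in>C t. walk_sum C R W t y)"
    by (intro sum.cong refl walk_sum_eq_sum_walks_to[OF fin, symmetric])
  finally show ?thesis .
qed

text \<open>A zigzag starts with a descent, so that its even times are local maxima.\<close>

definition zigzag_step :: "nat \<Rightarrow> nat \<Rightarrow> nat \<Rightarrow> bool" where
  "zigzag_step s x y \<longleftrightarrow> (if even s then y \<le> x else x \<le> y)"

abbreviation zigzag_sum :: "nat \<Rightarrow> (nat \<Rightarrow> 'a::comm_ring_1) \<Rightarrow> nat \<Rightarrow> nat \<Rightarrow> 'a" where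
  "zigzag_sum M w \<equiv> walk_sum (\<lambda>_. {..M}) zigzag_step (\<lambda>_. w)"

definition zigzag_total :: "nat \<Rightarrow> (nat \<Rightarrow> 'a::comm_ring_1) \<Rightarrow> nat \<Rightarrow> 'a" where
  "zigzag_total M w s = (\<Sum>y\<le>M. zigzag_sum M w s y)"


section \<open>Interlacing strips\<close>

text \<open>\<open>k\<close> strips are spread over the times \<open>0, \<dots>, 2 n + 4 k - 4\<close>, which stand for the diagonals of the skew
  staircase from left to right. Strip \<open>r\<close> begins at time \<open>2 (k - 1 - r)\<close> and ends at time
  \<open>2 (n + k - 1 + r)\<close>; thus on the left a strip is added at every even time, from the outermost to
  the innermost, and on the right the strips disappear in the opposite order.\<close>

locale strips =
  fixes n k :: nat
  assumes n: "1 \<le> n" and k: "1 \<le> k"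
begin

text \<open>Written without subtraction on natural numbers, this is \<open>2 (k - 1 - r) \<le> t \<le> 2 (n + k - 1 + r)\<close>.\<close>

definition alive :: "nat \<Rightarrow> nat set" where
  "alive t = {r. r < k \<and> 2 * k \<le> t + 2 * r + 2 \<and> t + 2 \<le> 2 * (n + k + r)}"

definition final :: nat where
  "final = 2 * n + 4 * k - 4"

text \<open>Even times carry the upper ends (local maxima) \<open>o\<^sub>r\<close> of the strips, odd times their lower ends
  \<open>i\<^sub>r\<close>. In both cases the condition says \<open>i\<^sub>r \<le> o\<^sub>r < i\<^sub>r\<^sub>+\<^sub>1 \<le> o\<^sub>r\<^sub>+\<^sub>1\<close>, for those strips that are
  present.\<close>

definition interlace :: "nat \<Rightarrow> (nat \<Rightarrow> nat) \<Rightarrow> (nat \<Rightarrow> nat) \<Rightarrow> bool" where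
  "interlace t x y \<longleftrightarrow> (if even t
     then (\<forall>r\<in>alive t \<inter> alive (Suc t). y r \<le> x r) \<and>
          (\<forall>r\<in>alive t. Suc r \<in> alive (Suc t) \<longrightarrow> x r < y (Suc r))
     else (\<forall>r\<in>alive t \<inter> alive (Suc t). x r \<le> y r) \<and>
          (\<forall>r\<in>alive (Suc t). Suc r \<in> alive t \<longrightarrow> y r < x (Suc r)))"

definition configs :: "nat \<Rightarrow> nat \<Rightarrow> (nat \<Rightarrow> nat) set" where
  "configs M t = alive t \<rightarrow>\<^sub>E {..M}"

lemma alive_subset: "alive t \<subseteq> {..<k}"
  by (auto simp: alive_def)

lemma finite_alive: "finite (alive t)"
  using alive_subset finite_subset by blast

lemma finite_configs: "finite (configs M t)"
  by (simp add: configs_def finite_PiE finite_alive)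

end

locale weighted_strips = strips +
  fixes M :: nat and w :: "nat \<Rightarrow> 'a::comm_ring_1"
begin

definition config_weight :: "nat \<Rightarrow> (nat \<Rightarrow> nat) \<Rightarrow> 'a" where
  "config_weight t x = (\<Prod>r\<in>alive t. w (x r))"

definition increasing :: "nat \<Rightarrow> (nat \<Rightarrow> nat) \<Rightarrow> bool" where
  "increasing t x \<longleftrightarrow> (\<forall>r\<in>alive t. Suc r \<in> alive t \<longrightarrow> x r < x (Suc r))"

definition start :: "nat \<Rightarrow> nat" where
  "start i = 2 * (k - 1 - i)"

text \<open>The weight of all single paths that enter where strip \<open>i\<close> begins and are at \<open>x\<close> at time \<open>t\<close>. It is
  \<open>0\<close> as long as the path has not yet entered.\<close>

definition arrive :: "nat \<Rightarrow> nat \<Rightarrow> nat \<Rightarrow> 'a" where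
  "arrive t i x = (if start i \<le> t then zigzag_sum M w (t - start i) x else 0)"

text \<open>The rows of strips that are not present. Before strip \<open>j\<close> begins, a unit row reserves the row and
  column of the path that will enter there. After strip \<open>j\<close> has ended, its row holds the total weights
  of the paths that have left at the end of strip \<open>j\<close>: the path from the beginning of strip \<open>i\<close> takes
  \<open>2 (n + i + j)\<close> steps to reach it.\<close>

definition absent :: "nat \<Rightarrow> nat \<Rightarrow> nat \<Rightarrow> 'a" where
  "absent t j i = (if t < start j then (if i = j then 1 else 0) else zigzag_total M w (2 * (n + i + j)))"

text \<open>Rows belong to strips, columns to starting points of paths. Its determinant is the weight of all
  interlacing configurations up to time \<open>t\<close> that end in \<open>y\<close> (\<open>walk_sum_eq_fdet\<close>).\<close>

definition path_matrix :: "nat \<Rightarrow> (nat \<Rightarrow> nat) \<Rightarrow> nat \<Rightarrow> nat \<Rightarrow> 'a" where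
  "path_matrix t y j i = (if j \<in> alive t then arrive t i (y j) else absent t j i)"

lemma prod_alive: "(\<Prod>j<k. if j \<in> alive t then c j else 1) = (\<Prod>j\<in>alive t. c j :: 'a)"
proof -
  have "(\<Prod>j<k. if j \<in> alive t then c j else 1) = (\<Prod>j\<in>{j \<in> {..<k}. j \<in> alive t}. c j)"
    by (subst prod.inter_filter) auto
  also have "{j \<in> {..<k}. j \<in> alive t} = alive t" using alive_subset by auto
  finally show ?thesis .
qed

lemma walk_sum_start:
  shows "config_weight 0 y = fdet k (path_matrix 0 y)"
proof -
  have alive0: "alive 0 = {k - 1}" using n k by (auto simp: alive_def)
  have "fdet k (path_matrix 0 y) =
      fdet k (\<lambda>j i. (if j \<in> alive 0 then w (y j) else 1) * (if i = j then 1 else 0))"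
    by (rule fdet_cong)
       (auto simp: path_matrix_def alive0 arrive_def absent_def start_def)
  also have "\<dots> = (\<Prod>j<k. if j \<in> alive 0 then w (y j) else 1) * fdet k (\<lambda>j i. if i = j then 1 else 0)"
    by (rule fdet_scale_rows)
  also have "fdet k (\<lambda>j i. if i = j then 1 else 0 :: 'a) = det (1\<^sub>m k)"
    by (intro arg_cong[where f=det] eq_matI) auto
  finally show ?thesis by (simp add: prod_alive config_weight_def)
qed

text \<open>For fixed \<open>y\<close> the entry \<open>x\<^sub>j\<close> runs through the interval from \<open>y\<^sub>j\<close> (included) to \<open>y\<^sub>j\<^sub>+\<^sub>1\<close> (excluded), a
  difference of two upper sets, so that row \<open>j\<close> is a difference \<open>F (y\<^sub>j) - F (y\<^sub>j\<^sub>+\<^sub>1)\<close> which subtraction of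
  the next row produces from \<open>F (y\<^sub>j)\<close>. A strip that ends at time \<open>t\<close> has no \<open>y\<^sub>j\<close>: its entry is only
  bounded above, as if \<open>y\<^sub>j\<close> were \<open>0\<close>, and \<open>F 0\<close> is the row of total weights required by \<open>absent\<close>.\<close>

lemma outer_to_inner:
  assumes t: "even t" and y: "y \<in> configs M (Suc t)" and inc: "increasing (Suc t) y"
  shows "config_weight (Suc t) y * (\<Sum>x | x \<in> configs M t \<and> interlace t x y. fdet k (path_matrix t x)) =
    fdet k (path_matrix (Suc t) y)"
proof -
  have step: "Suc j \<in> alive (Suc t)" if "j \<in> alive t" "Suc j < k" for j
    using that by (auto simp: alive_def)
  obtain h where h: "t = 2 * h" using t by (rule evenE)
  have sub: "j \<in> alive t" if "j \<in> alive (Suc t)" for j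
  proof -
    have "2 * k \<le> Suc (2 * (h + j + 1))" "2 * h + 2 \<le> 2 * (n + k + j)"
      using that unfolding alive_def h by auto
    moreover from this have "k \<le> h + j + 1" by presburger
    ultimately show ?thesis using that unfolding alive_def h by auto
  qed
  have yM: "y j \<le> M" if "j \<in> alive (Suc t)" for j
    using y that by (auto simp: configs_def)
  define S where "S j = {x. x \<le> M \<and> (j \<in> alive (Suc t) \<longrightarrow> y j \<le> x) \<and> (Suc j < k \<longrightarrow> x < y (Suc j))}" for j
  \<comment> \<open>the lower bound of the interval, with default \<open>0\<close> for a strip that ends at time \<open>t\<close>\<close>
  define z where "z j = (if j \<in> alive (Suc t) then y j else 0)" for j
  define F where "F i a = (\<Sum>x | x \<le> M \<and> a \<le> x. arrive t i x)" for i a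
  define B where "B j i = (if j \<in> alive t then F i (z j) else absent t j i)" for j i
  have finS: "finite (S j)" for j by (rule finite_subset[of _ "{..M}"]) (auto simp: S_def)
  have "Suc j < k \<longleftrightarrow> Suc j \<in> alive (Suc t)" if "j \<in> alive t" for j
    using step[OF that] alive_subset by auto
  then have "x \<in> configs M t \<and> interlace t x y \<longleftrightarrow> x \<in> PiE (alive t) S" for x
    using t sub unfolding configs_def interlace_def S_def PiE_iff by auto
  then have "(\<Sum>x | x \<in> configs M t \<and> interlace t x y. fdet k (path_matrix t x)) =
      (\<Sum>x\<in>PiE (alive t) S. fdet k (\<lambda>j i. if j \<in> alive t then arrive t i (x j) else absent t j i))"
    by (simp add: path_matrix_def)
  also have "\<dots> = fdet k (\<lambda>j i. if j \<in> alive t then \<Sum>x\<in>S j. arrive t i x else absent t j i)"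
    by (rule fdet_sum_rows[symmetric]) (use alive_subset finS in auto)
  also have "\<dots> = fdet k (\<lambda>j i. if j \<in> alive t \<and> Suc j < k then B j i - B (Suc j) i else B j i)"
  proof (rule fdet_cong)
    fix j i assume "j < k" "i < k"
    have "(\<Sum>x\<in>S j. arrive t i x) = F i (z j) - F i (z (Suc j))" if j: "j \<in> alive t" "Suc j < k"
    proof -
      have Sj: "Suc j \<in> alive (Suc t)" using step j by blast
      then have "z j \<le> z (Suc j)"
        using inc by (auto simp: z_def increasing_def less_imp_le)
      then have "{x. x \<le> M \<and> z j \<le> x} = S j \<union> {x. x \<le> M \<and> z (Suc j) \<le> x}"
          "S j \<inter> {x. x \<le> M \<and> z (Suc j) \<le> x} = {}"
        using j Sj by (auto simp: S_def z_def)
      then have "F i (z j) = (\<Sum>x\<in>S j. arrive t i x) + F i (z (Suc j))"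
        unfolding F_def using finS by (simp add: sum.union_disjoint)
      then show ?thesis by simp
    qed
    moreover have "(\<Sum>x\<in>S j. arrive t i x) = F i (z j)" if "\<not> Suc j < k"
      using that by (auto simp: F_def S_def z_def intro!: sum.cong)
    ultimately show "(if j \<in> alive t then \<Sum>x\<in>S j. arrive t i x else absent t j i) =
        (if j \<in> alive t \<and> Suc j < k then B j i - B (Suc j) i else B j i)"
      using step sub by (auto simp: B_def)
  qed
  also have "\<dots> = fdet k B" by (rule fdet_subtract_next_row)
  finally have sum: "(\<Sum>x | x \<in> configs M t \<and> interlace t x y. fdet k (path_matrix t x)) = fdet k B" .
  have "fdet k (path_matrix (Suc t) y) = fdet k (\<lambda>j i. (if j \<in> alive (Suc t) then w (y j) else 1) * B j i)"
  proof (rule fdet_cong)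
    fix j i assume ji: "j < k" "i < k"
    have par: "even (t - start i)" "start i \<le> Suc t \<longleftrightarrow> start i \<le> t"
      using t unfolding start_def by presburger+
    show "path_matrix (Suc t) y j i = (if j \<in> alive (Suc t) then w (y j) else 1) * B j i"
    proof (cases "j \<in> alive (Suc t)")
      case True
      then show ?thesis using sub[of j] par
        by (auto simp: path_matrix_def B_def F_def arrive_def z_def zigzag_step_def Suc_diff_le)
    next
      case False
      show ?thesis
      proof (cases "j \<in> alive t")
        case True
        with False have tj: "t + 2 = 2 * (n + k + j)" using t by (auto simp: alive_def elim!: evenE)
        then have "start i \<le> t" "t - start i = 2 * (n + i + j)" "\<not> Suc t < start j"
          using ji n by (auto simp: start_def)
        then show ?thesis using True False
          by (simp add: path_matrix_def B_def F_def arrive_def z_def absent_def zigzag_total_def atMost_def)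
      next
        case dead: False
        have "t < start j \<longleftrightarrow> Suc t < start j" using t by (auto simp: start_def elim!: evenE)
        with dead False show ?thesis by (simp add: path_matrix_def B_def absent_def)
      qed
    qed
  qed
  also have "\<dots> = config_weight (Suc t) y * fdet k B"
    by (simp add: fdet_scale_rows prod_alive config_weight_def)
  finally show ?thesis using sum by simp
qed

text \<open>Now \<open>x\<^sub>j\<close> runs through the interval from \<open>y\<^sub>j\<^sub>-\<^sub>1\<close> (excluded) to \<open>y\<^sub>j\<close> (included), a difference of two lower
  sets. If a strip \<open>r\<close> begins at time \<open>t + 1\<close>, then \<open>y\<^sub>r\<close> has no predecessor \<open>x\<^sub>r\<close>. In the new matrix
  row \<open>j\<close> is \<open>e\<^sub>r + F (y\<^sub>j)\<close> for every \<open>j \<ge> r\<close>, with the unit vector \<open>e\<^sub>r\<close> for the entering path.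
  Subtracting adjacent rows cancels \<open>e\<^sub>r\<close> except in row \<open>r\<close>, so column \<open>r\<close> vanishes outside that row
  and its remainder \<open>F (y\<^sub>r)\<close> may be dropped.\<close>

lemma inner_to_outer:
  assumes t: "odd t" and y: "y \<in> configs M (Suc t)" and inc: "increasing (Suc t) y"
  shows "config_weight (Suc t) y * (\<Sum>x | x \<in> configs M t \<and> interlace t x y. fdet k (path_matrix t x)) =
    fdet k (path_matrix (Suc t) y)"
proof -
  obtain h where h: "t = 2 * h + 1" using t by (rule oddE)
  have sub: "j \<in> alive (Suc t)" if "j \<in> alive t" for j
  proof -
    have "Suc (2 * (h + 1)) \<le> 2 * (n + k + j)"
      using that unfolding alive_def h by auto
    then have "h + 2 \<le> n + k + j" by presburger
    then show ?thesis using that unfolding alive_def h by auto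
  qed
  have yM: "y j \<le> M" if "j \<in> alive (Suc t)" for j
    using y that by (auto simp: configs_def)
  \<comment> \<open>strip \<open>j - 1\<close> bounds the entry of strip \<open>j\<close> from below\<close>
  define below where "below j \<longleftrightarrow> 0 < j \<and> j - 1 \<in> alive (Suc t)" for j
  define S where "S j = {x. x \<le> y j \<and> (below j \<longrightarrow> y (j - 1) < x)}" for j
  define F where "F i a = (\<Sum>x\<le>a. arrive t i x)" for i a
  \<comment> \<open>the new matrix, up to the weights of the entries of \<open>y\<close>; the summand \<open>1\<close> is the entering path\<close>
  define B where "B j i = (if j \<in> alive (Suc t) then F i (y j) + (if start i = Suc t then 1 else 0)
    else absent t j i)" for j i
  define B' where "B' j i = (if (j \<in> alive (Suc t) \<and> below j) \<and> 0 < j then B j i - B (j - 1) i else B j i)" for j i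
  have finS: "finite (S j)" for j by (rule finite_subset[of _ "{..y j}"]) (auto simp: S_def)
  have "x \<in> configs M t \<and> interlace t x y \<longleftrightarrow> x \<in> PiE (alive t) S" for x
  proof -
    have "(\<forall>r\<in>alive (Suc t). Suc r \<in> alive t \<longrightarrow> y r < x (Suc r)) \<longleftrightarrow>
        (\<forall>j\<in>alive t. below j \<longrightarrow> y (j - 1) < x j)"
      unfolding below_def by (metis Suc_pred' diff_Suc_1 zero_less_Suc)
    then show ?thesis
      using t sub yM unfolding configs_def interlace_def S_def PiE_iff
      by (auto intro: order_trans)
  qed
  then have "(\<Sum>x | x \<in> configs M t \<and> interlace t x y. fdet k (path_matrix t x)) =
      (\<Sum>x\<in>PiE (alive t) S. fdet k (\<lambda>j i. if j \<in> alive t then arrive t i (x j) else absent t j i))"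
    by (simp add: path_matrix_def)
  also have "\<dots> = fdet k (\<lambda>j i. if j \<in> alive t then \<Sum>x\<in>S j. arrive t i x else absent t j i)"
    by (rule fdet_sum_rows[symmetric]) (use alive_subset finS in auto)
  also have "\<dots> = fdet k B'"
  proof -
    have old: "(\<Sum>x\<in>S j. arrive t i x) = B' j i" if j: "j \<in> alive t" and i: "i < k" for j i
    proof (cases "below j")
      case True
      then have j0: "0 < j" "j - 1 \<in> alive (Suc t)" by (auto simp: below_def)
      then have "y (j - 1) < y j"
        using inc sub[OF j] unfolding increasing_def by (metis Suc_pred')
      then have "{..y j} = S j \<union> {..y (j - 1)}" "S j \<inter> {..y (j - 1)} = {}"
        using True by (auto simp: S_def)
      then have "F i (y j) = (\<Sum>x\<in>S j. arrive t i x) + F i (y (j - 1))"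
        unfolding F_def using finS by (simp add: sum.union_disjoint)
      then show ?thesis using j0 sub[OF j] True by (simp add: B'_def B_def)
    next
      case False
      have "2 * k \<le> Suc t + 2 * (j - 1) + 2" if "0 < j"
        using j that t unfolding alive_def mem_Collect_eq by presburger
      moreover have "start i < Suc t" if "j = 0 \<or> Suc t + 2 > 2 * (n + k + (j - 1))"
        using that j n unfolding alive_def start_def by auto
      ultimately have "start i \<noteq> Suc t"
        using False j by (auto simp: below_def alive_def)
      then show ?thesis using False sub[OF j]
        by (simp add: B'_def B_def F_def S_def atMost_def)
    qed
    have dead: "absent t j i = B' j i" if "j \<notin> alive (Suc t)" for j i
      using that by (simp add: B'_def B_def)
    show ?thesis
    proof (cases "\<exists>r. r \<in> alive (Suc t) \<and> r \<notin> alive t")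
      case False
      with sub have "alive t = alive (Suc t)" by blast
      then show ?thesis using old dead by (intro fdet_cong) auto
    next
      case True
      then obtain r where r: "r \<in> alive (Suc t)" "r \<notin> alive t" by blast
      then have rk: "r < k" and rt: "start r = Suc t"
        using t by (auto simp: alive_def start_def elim!: oddE)
      have uniq: "j = r" if "j \<in> alive (Suc t)" "j \<notin> alive t" for j
        using that r t by (auto simp: alive_def elim!: oddE)
      have nb: "\<not> below r" using r t by (auto simp: below_def alive_def elim!: oddE)
      have arr0: "arrive t r x = 0" for x using rt by (simp add: arrive_def)
      have left: "t < start j" if "j < k" "j \<notin> alive (Suc t)" for j
        using that rt n rk t by (auto simp: alive_def start_def elim!: oddE)
      have oldr: "B' j r = 0" if j: "j \<in> alive t" for j
        using old[OF j rk] arr0 by simp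
      show ?thesis
      proof (rule fdet_row_with_lonely_column[OF rk, symmetric])
        fix j assume j: "j < k" "j \<noteq> r"
        show "B' j r = 0"
          using oldr[of j] dead[of j r, symmetric] left[of j] j uniq[of j]
          by (cases "j \<in> alive t") (auto simp: absent_def)
      next
        fix j i assume "j < k" "j \<noteq> r" "i < k"
        then show "B' j i = (if j \<in> alive t then \<Sum>x\<in>S j. arrive t i x else absent t j i)"
          using old dead[of j i, symmetric] uniq[of j] by (cases "j \<in> alive t") auto
      next
        show "B' r r = (if r \<in> alive t then \<Sum>x\<in>S r. arrive t r x else absent t r r)"
          using r nb rt arr0 by (simp add: B'_def B_def F_def absent_def)
      qed
    qed
  qed
  also have "\<dots> = fdet k B" unfolding B'_def by (rule fdet_subtract_previous_row)
  finally have sum: "(\<Sum>x | x \<in> configs M t \<and> interlace t x y. fdet k (path_matrix t x)) = fdet k B" .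
  have "fdet k (path_matrix (Suc t) y) = fdet k (\<lambda>j i. (if j \<in> alive (Suc t) then w (y j) else 1) * B j i)"
  proof (rule fdet_cong)
    fix j i assume ji: "j < k" "i < k"
    show "path_matrix (Suc t) y j i = (if j \<in> alive (Suc t) then w (y j) else 1) * B j i"
    proof (cases "j \<in> alive (Suc t)")
      case True
      have "{x. x \<le> M \<and> x \<le> y j} = {..y j}" using yM[OF True] by auto
      moreover have "odd (t - start i)" if "start i \<le> t" using t that by (simp add: start_def)
      ultimately show ?thesis using True
        by (auto simp: path_matrix_def B_def F_def arrive_def zigzag_step_def Suc_diff_le not_le)
    next
      case False
      have "t < start j \<longleftrightarrow> Suc t < start j" using False ji n t
        by (auto simp: start_def alive_def elim!: oddE)
      with False show ?thesis by (simp add: path_matrix_def B_def absent_def)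
    qed
  qed
  also have "\<dots> = config_weight (Suc t) y * fdet k B"
    by (simp add: fdet_scale_rows prod_alive config_weight_def)
  finally show ?thesis using sum by simp
qed

lemma interlace_increasing:
  assumes "interlace t x y" "increasing (Suc t) y"
  shows "increasing t x"
  unfolding increasing_def
proof (intro ballI impI)
  fix r assume r: "r \<in> alive t" "Suc r \<in> alive t"
  show "x r < x (Suc r)"
  proof (cases "even t")
    case True
    have "Suc r \<in> alive (Suc t)" using r by (auto simp: alive_def)
    then show ?thesis using True r assms(1) unfolding interlace_def
      by (metis IntI less_le_trans)
  next
    case False
    have "r \<in> alive (Suc t)" using r False unfolding alive_def mem_Collect_eq by presburger
    then show ?thesis using False r assms(1) unfolding interlace_def
      by (metis IntI le_less_trans)
  qed
qed

text \<open>Only increasing \<open>y\<close> are admitted, since otherwise the intervals between the \<open>y\<^sub>j\<close> are not differences of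
  nested sets.\<close>

lemma walk_sum_eq_fdet:
  assumes "y \<in> configs M t" "increasing t y"
  shows "walk_sum (configs M) interlace config_weight t y = fdet k (path_matrix t y)"
  using assms
proof (induction t arbitrary: y)
  case 0
  show ?case by (simp add: walk_sum_start)
next
  case (Suc t)
  have "(\<Sum>x | x \<in> configs M t \<and> interlace t x y. walk_sum (configs M) interlace config_weight t x) =
      (\<Sum>x | x \<in> configs M t \<and> interlace t x y. fdet k (path_matrix t x))"
    using Suc.IH Suc.prems interlace_increasing by (intro sum.cong) auto
  then show ?case
    using outer_to_inner[OF _ Suc.prems] inner_to_outer[OF _ Suc.prems]
    by (cases "even t") auto
qed

text \<open>At the final time only the outermost strip is left. Summing over its entry completes the last row of
  total weights.\<close>

theorem sum_walks_eq_fdet: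
  "(\<Sum>b\<in>walks (configs M) interlace final. \<Prod>t\<le>final. \<Prod>r\<in>alive t. w (b t r)) =
    fdet k (\<lambda>j i. zigzag_total M w (2 * (n + i + j)))"
proof -
  have alive_final: "alive final = {k - 1}" using n k by (auto simp: alive_def final_def)
  have "(\<Sum>b\<in>walks (configs M) interlace final. \<Prod>t\<le>final. \<Prod>r\<in>alive t. w (b t r)) =
      (\<Sum>y\<in>configs M final. walk_sum (configs M) interlace config_weight final y)"
    using sum_walks_eq_walk_sum[where C = "configs M" and R = interlace and W = config_weight and t = final] finite_configs
    by (simp add: config_weight_def)
  also have "\<dots> = (\<Sum>y\<in>alive final \<rightarrow>\<^sub>E {..M}. fdet k (\<lambda>j i. if j \<in> alive final then arrive final i (y j) else absent final j i))"
    by (intro sum.cong) (auto simp: configs_def walk_sum_eq_fdet increasing_def alive_final path_matrix_def)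
  also have "\<dots> = fdet k (\<lambda>j i. if j \<in> alive final then \<Sum>x\<le>M. arrive final i x else absent final j i)"
    by (rule fdet_sum_rows[symmetric]) (use alive_subset in auto)
  also have "\<dots> = fdet k (\<lambda>j i. zigzag_total M w (2 * (n + i + j)))"
  proof (rule fdet_cong)
    fix j i assume ji: "j < k" "i < k"
    have *: "\<not> final < start j" "start i \<le> final" using ji n by (auto simp: final_def start_def)
    have "final - start i = 2 * (n + i + j)" if "j = k - 1"
      using ji that n by (auto simp: final_def start_def)
    with * show "(if j \<in> alive final then \<Sum>x\<le>M. arrive final i x else absent final j i) =
        zigzag_total M w (2 * (n + i + j))"
      by (auto simp: alive_final arrive_def absent_def zigzag_total_def)
  qed
  finally show ?thesis .
qed

end

section \<open>Generating functions by size\<close>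

no_notation vec_index (infixl "$" 100)

definition size_series :: "('c \<Rightarrow> nat) \<Rightarrow> 'c set \<Rightarrow> rat fps" where
  "size_series wt A = Abs_fps (\<lambda>N. of_nat (card {a \<in> A. wt a = N}))"

lemma size_series_nth: "fps_nth (size_series wt A) N = of_nat (card {a \<in> A. wt a = N})"
  by (simp add: size_series_def)

lemma size_series_bij:
  assumes bij: "bij_betw f A B" and wt: "\<And>a. a \<in> A \<Longrightarrow> wt' (f a) = wt a + c"
  shows "size_series wt' B = fps_X ^ c * size_series wt A"
proof (rule fps_ext)
  fix N
  have inj: "inj_on f A" and im: "f ` A = B" using bij by (auto simp: bij_betw_def)
  show "size_series wt' B $ N = (fps_X ^ c * size_series wt A) $ N"
  proof (cases "N < c")
    case True
    then have "card {b \<in> B. wt' b = N} = 0" using wt im by (auto simp: card_eq_0_iff)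
    then show ?thesis using True by (simp add: size_series_nth fps_X_power_mult_nth)
  next
    case False
    then have "{b \<in> B. wt' b = N} = f ` {a \<in> A. wt a = N - c}" using wt im by auto
    then have "card {b \<in> B. wt' b = N} = card {a \<in> A. wt a = N - c}"
      using inj by (simp add: card_image inj_on_subset)
    then show ?thesis using False by (simp add: size_series_nth fps_X_power_mult_nth)
  qed
qed

lemma size_series_UN:
  assumes "finite I" and disj: "disjoint_family_on A I"
    and fin: "\<And>i N. i \<in> I \<Longrightarrow> finite {a \<in> A i. wt a = N}"
  shows "size_series wt (\<Union>i\<in>I. A i) = (\<Sum>i\<in>I. size_series wt (A i))"
proof (rule fps_ext)
  fix N
  have "{a \<in> (\<Union>i\<in>I. A i). wt a = N} = (\<Union>i\<in>I. {a \<in> A i. wt a = N})" by auto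
  then have "card {a \<in> (\<Union>i\<in>I. A i). wt a = N} = (\<Sum>i\<in>I. card {a \<in> A i. wt a = N})"
    using assms by (subst card_UN_disjoint[symmetric]) (auto simp: disjoint_family_on_def)
  then show "size_series wt (\<Union>i\<in>I. A i) $ N = (\<Sum>i\<in>I. size_series wt (A i)) $ N"
    by (simp add: size_series_nth fps_sum_nth)
qed

lemma size_series_finite:
  assumes "finite A"
  shows "size_series wt A = (\<Sum>a\<in>A. fps_X ^ wt a)"
proof (rule fps_ext)
  fix N
  have "of_nat (card {a \<in> A. wt a = N}) = (\<Sum>a\<in>{a \<in> A. wt a = N}. 1 :: rat)" by simp
  also have "\<dots> = (\<Sum>a\<in>A. if wt a = N then 1 else 0)"
    using assms by (simp only: sum.inter_filter)
  finally show "size_series wt A $ N = (\<Sum>a\<in>A. fps_X ^ wt a) $ N"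
    by (simp add: size_series_nth fps_sum_nth fps_X_power_nth eq_commute)
qed


lemma fps_prod_nth_cong:
  assumes "\<And>x i. x \<in> A \<Longrightarrow> i \<le> N \<Longrightarrow> f x $ i = g x $ i"
  shows "\<forall>i\<le>N. (\<Prod>x\<in>A. f x :: 'a::comm_ring_1 fps) $ i = (\<Prod>x\<in>A. g x) $ i"
  using assms
proof (induction A rule: infinite_finite_induct)
  case (insert x A)
  then show ?case by (auto simp: fps_mult_nth intro!: sum.cong)
qed auto

text \<open>Coefficients up to \<open>N\<close> of a determinant depend only on the coefficients up to \<open>N\<close> of its entries, so
  that truncated generating functions can be used in place of full ones.\<close>

lemma fdet_nth_cong:
  assumes "\<And>j i l. j < k \<Longrightarrow> i < k \<Longrightarrow> l \<le> N \<Longrightarrow> f j i $ l = g j i $ l"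
  shows "fdet k f $ N = fdet k g $ N"
proof -
  have "(of_int (sign p) * (\<Prod>j<k. f j (p j))) $ N = (of_int (sign p) * (\<Prod>j<k. g j (p j))) $ N"
    if "p permutes {..<k}" for p
  proof -
    have "\<forall>l\<le>N. (\<Prod>j<k. f j (p j)) $ l = (\<Prod>j<k. g j (p j)) $ l"
      using assms permutes_in_image[OF that] by (intro fps_prod_nth_cong) auto
    then show ?thesis by (auto simp: fps_mult_nth intro!: sum.cong)
  qed
  then show ?thesis by (simp add: fdet_leibniz fps_sum_nth)
qed

section \<open>Zigzag sequences and alternating permutations\<close>

definition decreasing_seqs :: "nat \<Rightarrow> (nat \<Rightarrow> nat) set" where
  "decreasing_seqs m = {d \<in> {1..m} \<rightarrow>\<^sub>E UNIV. \<forall>i\<in>{1..<m}. d (Suc i) \<le> d i}"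

lemma finite_sum_level:
  assumes "finite A" and "X \<subseteq> A \<rightarrow>\<^sub>E (UNIV :: nat set)"
  shows "finite {a \<in> X. sum a A = N}"
proof (rule finite_subset)
  show "finite (A \<rightarrow>\<^sub>E {..N})" using assms(1) by (simp add: finite_PiE)
  show "{a \<in> X. sum a A = N} \<subseteq> A \<rightarrow>\<^sub>E {..N}"
    using assms by (auto simp: PiE_def intro: member_le_sum)
qed

text \<open>A weakly decreasing sequence of length \<open>m + 1\<close> either ends in \<open>0\<close> and is a sequence of length \<open>m\<close>,
  or \<open>1\<close> can be subtracted from all of its entries. Hence \<open>P\<^sub>m\<^sub>+\<^sub>1 = P\<^sub>m + q\<^sup>m\<^sup>+\<^sup>1 P\<^sub>m\<^sub>+\<^sub>1\<close>.\<close>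

lemma size_series_decreasing_seqs:
  "size_series (\<lambda>d. sum d {1..m}) (decreasing_seqs m) * q_pochhammer fps_X fps_X m = 1"
proof (induction m)
  case 0
  have "decreasing_seqs 0 = {\<lambda>_. undefined}" by (auto simp: decreasing_seqs_def)
  then show ?case by (simp add: size_series_finite q_pochhammer_def)
next
  case (Suc m)
  let ?D = "decreasing_seqs (Suc m)"
  let ?P = "\<lambda>m. size_series (\<lambda>d. sum d {1..m})"
  define A where "A c = {d \<in> ?D. (d (Suc m) > 0) = c}" for c
  have "bij_betw (\<lambda>d. d(Suc m := 0)) (decreasing_seqs m) (A False)"
  proof (rule bij_betw_byWitness[where f' = "\<lambda>d. d(Suc m := undefined)"])
    show "\<forall>d\<in>decreasing_seqs m. (d(Suc m := 0))(Suc m := undefined) = d"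
      by (auto simp: decreasing_seqs_def PiE_iff extensional_def)
    show "\<forall>d\<in>A False. (d(Suc m := undefined))(Suc m := 0) = d"
      by (auto simp: A_def)
    show "(\<lambda>d. d(Suc m := 0)) ` decreasing_seqs m \<subseteq> A False"
      by (auto simp: decreasing_seqs_def PiE_iff extensional_def A_def)
    show "(\<lambda>d. d(Suc m := undefined)) ` A False \<subseteq> decreasing_seqs m"
      by (auto simp: decreasing_seqs_def PiE_iff extensional_def A_def)
  qed
  then have A0: "?P (Suc m) (A False) = fps_X ^ 0 * ?P m (decreasing_seqs m)"
    by (rule size_series_bij) (auto intro!: sum.cong)
  have last: "d i > 0" if "d \<in> ?D" "0 < d (Suc m)" "i \<in> {1..Suc m}" for d i
  proof -
    have "i \<le> Suc m" using that by simp
    then show ?thesis using that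
    proof (induction rule: inc_induct)
      case (step l)
      then have "d (Suc l) \<le> d l" by (auto simp: decreasing_seqs_def)
      with step show ?case by auto
    qed auto
  qed
  have "bij_betw (\<lambda>d. \<lambda>i\<in>{1..Suc m}. d i + 1) ?D (A True)"
  proof (rule bij_betw_byWitness[where f' = "\<lambda>d. \<lambda>i\<in>{1..Suc m}. d i - 1"])
    show "\<forall>d\<in>?D. (\<lambda>i\<in>{1..Suc m}. (\<lambda>i\<in>{1..Suc m}. d i + 1) i - 1) = d"
      by (auto simp: decreasing_seqs_def PiE_iff extensional_def fun_eq_iff)
    show "\<forall>d\<in>A True. (\<lambda>i\<in>{1..Suc m}. (\<lambda>i\<in>{1..Suc m}. d i - 1) i + 1) = d"
    proof
      fix d assume "d \<in> A True"
      then have "d \<in> ?D" "0 < d (Suc m)" by (auto simp: A_def)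
      then show "(\<lambda>i\<in>{1..Suc m}. (\<lambda>i\<in>{1..Suc m}. d i - 1) i + 1) = d"
        using last[of d] by (auto simp: decreasing_seqs_def PiE_iff extensional_def fun_eq_iff)
    qed
    show "(\<lambda>d. \<lambda>i\<in>{1..Suc m}. d i + 1) ` ?D \<subseteq> A True"
      by (auto simp: decreasing_seqs_def A_def)
    show "(\<lambda>d. \<lambda>i\<in>{1..Suc m}. d i - 1) ` A True \<subseteq> ?D"
      by (auto simp: decreasing_seqs_def A_def diff_le_mono)
  qed
  then have A1: "?P (Suc m) (A True) = fps_X ^ Suc m * ?P (Suc m) ?D"
  proof (rule size_series_bij)
    fix d :: "nat \<Rightarrow> nat"
    have "sum (\<lambda>i\<in>{1..Suc m}. d i + 1) {1..Suc m} = (\<Sum>i\<in>{1..Suc m}. d i + 1)"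
      by (rule sum.cong) auto
    then show "sum (\<lambda>i\<in>{1..Suc m}. d i + 1) {1..Suc m} = sum d {1..Suc m} + Suc m"
      by (simp only: sum.distrib) simp
  qed
  have "?D = (\<Union>c\<in>UNIV. A c)" by (auto simp: A_def)
  moreover have "A c \<subseteq> {1..Suc m} \<rightarrow>\<^sub>E UNIV" for c
    by (auto simp: A_def decreasing_seqs_def)
  then have "finite {a \<in> A c. sum a {1..Suc m} = N}" for c N by (intro finite_sum_level) auto
  then have "?P (Suc m) (\<Union>c\<in>UNIV. A c) = (\<Sum>c\<in>UNIV. ?P (Suc m) (A c))"
    by (intro size_series_UN) (auto simp: disjoint_family_on_def A_def)
  ultimately have "?P (Suc m) ?D = (\<Sum>c\<in>UNIV. ?P (Suc m) (A c))" by simp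
  then have "?P (Suc m) ?D = ?P m (decreasing_seqs m) + fps_X ^ Suc m * ?P (Suc m) ?D"
    using A0 A1 by (simp add: UNIV_bool)
  then have "?P (Suc m) ?D * (1 - fps_X ^ Suc m) = ?P m (decreasing_seqs m)"
    by (simp add: algebra_simps)
  then have "?P (Suc m) ?D * q_pochhammer fps_X fps_X (Suc m) =
      ?P m (decreasing_seqs m) * q_pochhammer fps_X fps_X m"
    by (simp add: q_pochhammer_def mult_ac)
  then show ?case using Suc.IH by simp
qed

lemma permutes_eq_rank:
  assumes p: "p permutes {1..m::nat}" and j: "j \<in> {1..m}"
  shows "p j = card {i \<in> {1..m}. p i \<le> p j}"
proof -
  have "p ` {i \<in> {1..m}. p i \<le> p j} = {1..p j}"
  proof (intro equalityI subsetI)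
    fix l assume "l \<in> {1..p j}"
    moreover have "p j \<le> m" using permutes_in_image[OF p] j by auto
    ultimately have l: "l \<in> {1..m}" "l \<le> p j" by auto
    then have "l \<in> p ` {1..m}" using permutes_image[OF p] by simp
    with l show "l \<in> p ` {i \<in> {1..m}. p i \<le> p j}" by auto
  qed (use permutes_in_image[OF p] in force)
  then have "card (p ` {i \<in> {1..m}. p i \<le> p j}) = p j" by simp
  then show ?thesis
    using permutes_inj[OF p] by (simp add: card_image inj_on_def)
qed

text \<open>The permutation is forced: it has to map every position to its rank in the order \<open>R\<close>.\<close>

lemma ex1_permutation_ranking_order:
  assumes irrefl: "\<And>i. \<not> R i i" and trans: "\<And>i j l. R i j \<Longrightarrow> R j l \<Longrightarrow> R i l"
    and total: "\<And>i j. i \<in> {1..m} \<Longrightarrow> j \<in> {1..m} \<Longrightarrow> i \<noteq> j \<Longrightarrow> R i j \<or> R j i"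
  shows "\<exists>!p. p permutes {1..m::nat} \<and> (\<forall>i\<in>{1..m}. \<forall>j\<in>{1..m}. p i < p j \<longleftrightarrow> R i j)"
proof -
  define L where "L j = {i \<in> {1..m}. i = j \<or> R i j}" for j
  define p where "p j = (if j \<in> {1..m} then card (L j) else j)" for j
  have finL: "finite (L j)" for j by (simp add: L_def)
  have mono: "p i < p j" if "i \<in> {1..m}" "j \<in> {1..m}" "R i j" for i j
  proof -
    have "L i \<subseteq> L j" "j \<in> L j" "j \<notin> L i" using that trans irrefl by (auto simp: L_def)
    then have "L i \<subset> L j" by blast
    then show ?thesis using that finL by (simp add: p_def psubset_card_mono)
  qed
  have iff: "p i < p j \<longleftrightarrow> R i j" if "i \<in> {1..m}" "j \<in> {1..m}" for i j
    using that mono[of i j] mono[of j i] total[of i j] by (metis less_asym less_irrefl)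
  have "inj_on p {1..m}"
  proof (rule inj_onI)
    fix i j assume "i \<in> {1..m}" "j \<in> {1..m}" "p i = p j"
    then show "i = j" using mono[of i j] mono[of j i] total[of i j] by auto
  qed
  moreover have "p ` {1..m} \<subseteq> {1..m}"
  proof
    fix l assume "l \<in> p ` {1..m}"
    then obtain j where j: "j \<in> {1..m}" "l = card (L j)" by (auto simp: p_def)
    have "L j \<subseteq> {1..m}" "j \<in> L j" using j by (auto simp: L_def)
    then have "card (L j) \<le> card {1..m}" "0 < card (L j)"
      using finL[of j] by (auto simp only: card_gt_0_iff intro!: card_mono)
    then show "l \<in> {1..m}" using j by simp
  qed
  ultimately have "bij_betw p {1..m} {1..m}"
    by (simp add: bij_betw_def endo_inj_surj)
  then have perm: "p permutes {1..m}"
    by (rule bij_imp_permutes) (unfold p_def, simp only: if_False)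
  have uniq: "p' = p" if p': "p' permutes {1..m}" "\<forall>i\<in>{1..m}. \<forall>j\<in>{1..m}. p' i < p' j \<longleftrightarrow> R i j" for p'
  proof
    fix j
    show "p' j = p j"
    proof (cases "j \<in> {1..m}")
      case True
      have "{i \<in> {1..m}. p' i \<le> p' j} = L j"
        using p' True permutes_inj[OF p'(1)] by (auto simp: L_def le_less inj_eq)
      then show ?thesis using permutes_eq_rank[OF p'(1) True] True by (simp add: p_def)
    next
      case False
      then show ?thesis using permutes_not_in[OF p'(1)] by (auto simp: p_def)
    qed
  qed
  show ?thesis
  proof (rule ex1I)
    show "p permutes {1..m} \<and> (\<forall>i\<in>{1..m}. \<forall>j\<in>{1..m}. p i < p j \<longleftrightarrow> R i j)"
      using perm iff by blast
  qed (use uniq in blast)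
qed

text \<open>Positions are sorted by decreasing value; the label \<open>f\<close> decides between equal values.\<close>

definition precedes :: "(nat \<Rightarrow> nat) \<Rightarrow> (nat \<Rightarrow> nat) \<Rightarrow> nat \<Rightarrow> nat \<Rightarrow> bool" where
  "precedes f a i j \<longleftrightarrow> a j < a i \<or> a i = a j \<and> f i < f j"

text \<open>The sequences whose sorting order is \<open>p\<close>: position \<open>i\<close> comes at place \<open>p i\<close>.\<close>

definition sorted_by :: "nat \<Rightarrow> (nat \<Rightarrow> nat) \<Rightarrow> (nat \<Rightarrow> nat) \<Rightarrow> (nat \<Rightarrow> nat) set" where
  "sorted_by m f p = {a \<in> {1..m} \<rightarrow>\<^sub>E UNIV. \<forall>i\<in>{1..m}. \<forall>j\<in>{1..m}. p i < p j \<longleftrightarrow> precedes f a i j}"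

lemma sorted_by_subset: "sorted_by m f p \<subseteq> {1..m} \<rightarrow>\<^sub>E UNIV"
  by (auto simp only: sorted_by_def)

lemma ex1_sorting_permutation:
  assumes inj: "inj_on f {1..m}" and a: "a \<in> {1..m} \<rightarrow>\<^sub>E UNIV"
  shows "\<exists>!p. p permutes {1..m} \<and> a \<in> sorted_by m f p"
proof -
  have "\<exists>!p. p permutes {1..m} \<and> (\<forall>i\<in>{1..m}. \<forall>j\<in>{1..m}. p i < p j \<longleftrightarrow> precedes f a i j)"
  proof (rule ex1_permutation_ranking_order)
    fix i j assume "i \<in> {1..m}" "j \<in> {1..m}" "i \<noteq> j"
    then have "f i \<noteq> f j" using inj by (auto dest: inj_onD)
    then show "precedes f a i j \<or> precedes f a j i" by (auto simp: precedes_def)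
  qed (auto simp: precedes_def)
  then show ?thesis using a by (simp add: sorted_by_def)
qed

lemma maj_perm_word:
  "maj (perm_word m g) = (\<Sum>l | l \<in> {1..<m} \<and> g (Suc l) < g l. l)"
proof -
  have "{i. 1 \<le> i \<and> i < length (perm_word m g) \<and> perm_word m g ! i < perm_word m g ! (i - 1)} =
      {l. l \<in> {1..<m} \<and> g (Suc l) < g l}"
    by (auto simp: perm_word_def nth_append simp del: upt_Suc)
  then show ?thesis by (simp add: maj_def)
qed

text \<open>Read in sorted order, \<open>a \<in> sorted_by m f p\<close> becomes a weakly decreasing sequence which is strictly
  decreasing at the descents of the word \<open>f \<circ> p\<^sup>-\<^sup>1\<close>, since equal values have increasing labels.
  Subtracting from each entry the number of descents at or after its place leaves an arbitrary weakly
  decreasing sequence. A descent at \<open>l\<close> is subtracted from the first \<open>l\<close> entries, so all these numbers add up to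
  the major index.\<close>

lemma size_series_sorted_by:
  assumes p: "p permutes {1..m}" and inj: "inj_on f {1..m}"
  shows "size_series (\<lambda>a. sum a {1..m}) (sorted_by m f p) =
    fps_X ^ maj (perm_word m (f \<circ> inv_into UNIV p)) *
    size_series (\<lambda>d. sum d {1..m}) (decreasing_seqs m)"
proof -
  define s where "s = inv_into UNIV p"
  define g where "g = f \<circ> s"
  have ps: "p (s i) = i" and sp: "s (p i) = i" for i
    using permutes_inverses[OF p] by (simp_all add: s_def)
  have s: "s permutes {1..m}" using permutes_inv[OF p] by (simp add: s_def)
  have pm: "p i \<in> {1..m} \<longleftrightarrow> i \<in> {1..m}" and sm: "s i \<in> {1..m} \<longleftrightarrow> i \<in> {1..m}" for i
    using permutes_in_image[OF p] permutes_in_image[OF s] by blast+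
  \<comment> \<open>the number of descents at or after place \<open>i\<close>\<close>
  define des where "des i = card {l \<in> {i..<m}. g (Suc l) < g l}" for i
  have des_Suc: "des i = des (Suc i) + (if g (Suc i) < g i then 1 else 0)" if "i < m" for i
  proof -
    have "{l \<in> {i..<m}. g (Suc l) < g l} =
        (if g (Suc i) < g i then insert i {l \<in> {Suc i..<m}. g (Suc l) < g l}
         else {l \<in> {Suc i..<m}. g (Suc l) < g l})"
      using that by (auto simp: Suc_le_eq le_less)
    then show ?thesis by (simp add: des_def)
  qed
  have ginj: "g i \<noteq> g j" if "i \<in> {1..m}" "j \<in> {1..m}" "i \<noteq> j" for i j
    using that inj sm permutes_inj[OF s] unfolding g_def comp_def inj_on_def by blast
  let ?F = "\<lambda>d. \<lambda>j\<in>{1..m}. d (p j) + des (p j)"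
  let ?G = "\<lambda>a. \<lambda>i\<in>{1..m}. a (s i) - des i"
  have "bij_betw ?F (decreasing_seqs m) (sorted_by m f p)"
  proof (rule bij_betw_byWitness[where f' = ?G])
    show "\<forall>d\<in>decreasing_seqs m. ?G (?F d) = d"
      using sm ps by (auto simp: decreasing_seqs_def PiE_iff extensional_def fun_eq_iff)
    have des_step: "a (s (Suc l)) - des (Suc l) \<le> a (s l) - des l \<and> (des (Suc l) \<le> a (s (Suc l)) \<longrightarrow> des l \<le> a (s l))"
      if a: "a \<in> sorted_by m f p" and l: "l \<in> {1..<m}" for a l
    proof -
      have "precedes f a (s l) (s (Suc l))"
      proof -
        have "s l \<in> {1..m}" "s (Suc l) \<in> {1..m}" using l sm by auto
        then have "p (s l) < p (s (Suc l)) \<longleftrightarrow> precedes f a (s l) (s (Suc l))"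
          using a unfolding sorted_by_def by blast
        then show ?thesis by (simp add: ps)
      qed
      then show ?thesis using des_Suc[of l] l by (auto simp: precedes_def g_def)
    qed
    have des_le: "des i \<le> a (s i)" if a: "a \<in> sorted_by m f p" and i: "i \<in> {1..m}" for a i
    proof -
      have "i \<le> m" using i by simp
      then show ?thesis using i
      proof (induction rule: inc_induct)
        case base show ?case by (simp add: des_def)
      next
        case (step l)
        then show ?case using des_step[OF a, of l] by auto
      qed
    qed
    show "\<forall>a\<in>sorted_by m f p. ?F (?G a) = a"
    proof
      fix a assume a: "a \<in> sorted_by m f p"
      then have "a \<in> extensional {1..m}" by (auto simp: sorted_by_def PiE_iff)
      moreover have "?F (?G a) j = a j" if "j \<in> {1..m}" for j
        using des_le[OF a, of "p j"] pm[of j] sp[of j] that by simp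
      ultimately show "?F (?G a) = a" by (intro extensionalityI[of _ "{1..m}"]) auto
    qed
    show "?G ` sorted_by m f p \<subseteq> decreasing_seqs m"
      using des_step by (auto simp: decreasing_seqs_def)
    show "?F ` decreasing_seqs m \<subseteq> sorted_by m f p"
    proof (intro image_subsetI)
      fix d assume d: "d \<in> decreasing_seqs m"
      define e where "e i = d i + des i" for i
      have adj: "e (Suc l) < e l \<or> e l = e (Suc l) \<and> g l < g (Suc l)" if l: "l \<in> {1..<m}" for l
      proof -
        have "d (Suc l) \<le> d l" using d l by (simp add: decreasing_seqs_def)
        moreover have "g l \<noteq> g (Suc l)" using l by (intro ginj) auto
        ultimately show ?thesis using des_Suc[of l] l by (auto simp: e_def)
      qed
      have main: "e j < e i \<or> e i = e j \<and> g i < g j" if ij: "i < j" "i \<in> {1..m}" "j \<in> {1..m}" for i j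
      proof -
        have "Suc i \<le> j" using ij by simp
        then show ?thesis using ij(3)
        proof (induction rule: dec_induct)
          case base
          then show ?case using adj[of i] ij by auto
        next
          case (step l)
          then show ?case using adj[of l] ij by auto
        qed
      qed
      have "p i < p j \<longleftrightarrow> precedes f (?F d) i j" if ij: "i \<in> {1..m}" "j \<in> {1..m}" for i j
      proof -
        have prec: "precedes f (?F d) i j \<longleftrightarrow> e (p j) < e (p i) \<or> e (p i) = e (p j) \<and> g (p i) < g (p j)"
          using ij by (simp add: precedes_def e_def g_def sp)
        have "p i \<in> {1..m}" "p j \<in> {1..m}" using ij pm by blast+
        then have "p i < p j \<Longrightarrow> ?thesis" "p j < p i \<Longrightarrow> ?thesis"
          unfolding prec using main[of "p i" "p j"] main[of "p j" "p i"] by auto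
        moreover have "p i = p j \<Longrightarrow> ?thesis" unfolding prec by simp
        ultimately show ?thesis using linorder_less_linear[of "p i" "p j"] by blast
      qed
      then show "?F d \<in> sorted_by m f p" by (auto simp: sorted_by_def)
    qed
  qed
  then have "size_series (\<lambda>a. sum a {1..m}) (sorted_by m f p) =
    fps_X ^ (\<Sum>i\<in>{1..m}. des i) * size_series (\<lambda>d. sum d {1..m}) (decreasing_seqs m)"
  proof (rule size_series_bij)
    fix d
    have "sum (?F d) {1..m} = (\<Sum>j\<in>{1..m}. d (p j) + des (p j))" by (rule sum.cong) auto
    also have "\<dots> = (\<Sum>i\<in>{1..m}. d i + des i)"
      using sum.permute[OF p, of "\<lambda>i. d i + des i"] by (simp add: comp_def)
    finally show "sum (?F d) {1..m} = sum d {1..m} + sum des {1..m}" by (simp add: sum.distrib)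
  qed
  also have "(\<Sum>i\<in>{1..m}. des i) = maj (perm_word m g)"
  proof -
    define Q where "Q = {l \<in> {1..<m}. g (Suc l) < g l}"
    have "des i = (\<Sum>l\<in>Q. if i \<le> l then 1 else 0)" if "i \<in> {1..m}" for i
    proof -
      have "{l \<in> {i..<m}. g (Suc l) < g l} = {l \<in> Q. i \<le> l}" using that by (auto simp: Q_def)
      moreover have "card {l \<in> Q. i \<le> l} = (\<Sum>l\<in>Q. if i \<le> l then 1 else 0)"
        by (subst sum.inter_filter[symmetric]) (auto simp: Q_def)
      ultimately show ?thesis by (simp add: des_def)
    qed
    then have "(\<Sum>i\<in>{1..m}. des i) = (\<Sum>i\<in>{1..m}. \<Sum>l\<in>Q. if i \<le> l then 1 else 0)" by simp
    also have "\<dots> = (\<Sum>l\<in>Q. \<Sum>i\<in>{1..m}. if i \<le> l then 1 else 0)" by (rule sum.swap)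
    also have "\<dots> = (\<Sum>l\<in>Q. l)"
    proof (rule sum.cong[OF refl])
      fix l assume "l \<in> Q"
      then have "{i \<in> {1..m}. i \<le> l} = {1..l}" by (auto simp: Q_def)
      then show "(\<Sum>i\<in>{1..m}. if i \<le> l then 1 else 0) = l"
        by (subst sum.inter_filter[symmetric]) auto
    qed
    finally show ?thesis by (simp add: maj_perm_word Q_def)
  qed
  finally show ?thesis by (simp add: g_def s_def)
qed

text \<open>Odd positions are the local maxima, opposite to alternating permutations, because large values are
  sorted first.\<close>

definition zigzags :: "nat \<Rightarrow> (nat \<Rightarrow> nat) set" where
  "zigzags m = {a \<in> {1..m} \<rightarrow>\<^sub>E UNIV. \<forall>i\<in>{1..<m}. if odd i then a (Suc i) \<le> a i else a i \<le> a (Suc i)}"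

lemma kappa_involution: "kappa m (kappa m i) = i"
proof -
  have "i + 1 \<le> 2 * ((m - 1) div 2) + 1" if "even i" "i \<le> 2 * ((m - 1) div 2) + 1"
    using that by presburger
  moreover have "3 \<le> i" if "odd i" "2 \<le> i" using that by presburger
  ultimately show ?thesis by (cases "even i") (auto simp: kappa_def)
qed

lemma inj_kappa: "inj_on (kappa m) A"
  by (rule inj_on_inverseI) (rule kappa_involution)

text \<open>The labels increase from each local maximum of a zigzag to its neighbours: \<open>\<kappa>\<close> is a natural
  labelling. For odd \<open>m\<close> no position is left out of the transpositions except the first.\<close>

lemma kappa_zigzag:
  assumes "odd m" "i \<in> {1..<m}"
  shows "if odd i then kappa m i < kappa m (Suc i) else kappa m (Suc i) < kappa m i"
proof -
  have "Suc i \<le> 2 * ((m - 1) div 2) + 1" "even i \<or> i = 1 \<or> 2 \<le> i"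
    using assms by (auto elim!: oddE)
  then show ?thesis
    using assms(2) by (cases "even i") (auto simp: kappa_def)
qed

text \<open>By naturality of the labelling \<open>\<kappa>\<close>, the weak inequality \<open>a i \<ge> a j\<close> between a local maximum \<open>i\<close> and its neighbour \<open>j\<close>
  holds exactly if \<open>i\<close> is sorted before \<open>j\<close>.\<close>

lemma zigzags_eq_UN_sorted_by:
  assumes "odd m"
  shows "zigzags m = (\<Union>p\<in>alternating_perms m. sorted_by m (kappa m) p)"
proof (intro equalityI subsetI)
  fix a assume a: "a \<in> zigzags m"
  then have aE: "a \<in> {1..m} \<rightarrow>\<^sub>E UNIV" by (simp add: zigzags_def)
  have "inj_on (kappa m) {1..m}" by (rule inj_kappa)
  then obtain p where p: "p permutes {1..m}" "a \<in> sorted_by m (kappa m) p"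
    using ex1_sorting_permutation[OF _ aE] by blast
  have "if odd i then p i < p (Suc i) else p i > p (Suc i)" if i: "i \<in> {1..<m}" for i
  proof -
    have "if odd i then precedes (kappa m) a i (Suc i) else precedes (kappa m) a (Suc i) i"
      using kappa_zigzag[OF assms i] a[unfolded zigzags_def] i
      by (auto simp: precedes_def le_less dest: bspec[where x = i])
    then show ?thesis using p(2) i by (auto simp: sorted_by_def)
  qed
  with p show "a \<in> (\<Union>p\<in>alternating_perms m. sorted_by m (kappa m) p)"
    by (auto simp: alternating_perms_def)
next
  fix a assume "a \<in> (\<Union>p\<in>alternating_perms m. sorted_by m (kappa m) p)"
  then obtain p where p: "p \<in> alternating_perms m" "a \<in> sorted_by m (kappa m) p" by blast
  have "if odd i then a (Suc i) \<le> a i else a i \<le> a (Suc i)" if i: "i \<in> {1..<m}" for i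
  proof -
    have "if odd i then p i < p (Suc i) else p i > p (Suc i)"
      using p(1) i by (simp add: alternating_perms_def)
    then have "if odd i then precedes (kappa m) a i (Suc i) else precedes (kappa m) a (Suc i) i"
      using p(2) i by (auto simp: sorted_by_def)
    then show ?thesis by (auto simp: precedes_def split: if_splits)
  qed
  then show "a \<in> zigzags m" using p(2) by (auto simp: zigzags_def sorted_by_def)
qed

theorem size_series_zigzags:
  assumes "odd m"
  shows "size_series (\<lambda>a. sum a {1..m}) (zigzags m) * q_pochhammer fps_X fps_X m = q_Euler m fps_X"
proof -
  let ?P = "size_series (\<lambda>d. sum d {1..m})"
  have inj: "inj_on (kappa m) {1..m}" by (rule inj_kappa)
  have alt: "p permutes {1..m}" if "p \<in> alternating_perms m" for p
    using that by (simp add: alternating_perms_def)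
  have fin: "finite (alternating_perms m)"
    by (rule finite_subset[OF _ finite_permutations[of "{1..m}"]]) (auto simp: alternating_perms_def)
  have "disjoint_family_on (sorted_by m (kappa m)) (alternating_perms m)"
  proof (unfold disjoint_family_on_def, intro ballI impI, rule ccontr)
    fix p p' assume pp: "p \<in> alternating_perms m" "p' \<in> alternating_perms m" "p \<noteq> p'"
      and "sorted_by m (kappa m) p \<inter> sorted_by m (kappa m) p' \<noteq> {}"
    then obtain a where "a \<in> sorted_by m (kappa m) p" "a \<in> sorted_by m (kappa m) p'" by blast
    moreover from this have "a \<in> {1..m} \<rightarrow>\<^sub>E UNIV" by (simp add: sorted_by_def)
    ultimately show False
      using ex1_sorting_permutation[OF inj, of a] alt pp by blast
  qed
  then have "?P (zigzags m) = (\<Sum>p\<in>alternating_perms m. ?P (sorted_by m (kappa m) p))"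
    unfolding zigzags_eq_UN_sorted_by[OF assms] using fin
    by (intro size_series_UN finite_sum_level) (simp_all add: sorted_by_subset del: One_nat_def)
  also have "\<dots> = q_Euler m fps_X * ?P (decreasing_seqs m)"
    using size_series_sorted_by[OF alt inj] by (simp add: q_Euler_def sum_distrib_right)
  finally show ?thesis
    using size_series_decreasing_seqs[of m] by (simp add: mult.assoc)
qed

text \<open>An entry larger than \<open>N\<close> cannot occur in a sequence of sum \<open>N\<close>, so the bound \<open>M\<close> does not matter.\<close>

lemma zigzag_total_nth:
  assumes "N \<le> M"
  shows "zigzag_total M (\<lambda>y. fps_X ^ y) s $ N =
    size_series (\<lambda>a. sum a {1..Suc s}) (zigzags (Suc s)) $ N"
proof -
  let ?W = "walks (\<lambda>_. {..M}) zigzag_step s"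
  define A where "A = {a \<in> zigzags (Suc s). \<forall>i\<in>{1..Suc s}. a i \<le> M}"
  have "zigzag_total M (\<lambda>y. fps_X ^ y) s = (\<Sum>b\<in>?W. \<Prod>t\<le>s. fps_X ^ b t :: rat fps)"
    using sum_walks_eq_walk_sum[where C = "\<lambda>_. {..M}" and R = zigzag_step
        and W = "\<lambda>_ y. fps_X ^ y :: rat fps" and t = s]
    by (simp add: zigzag_total_def)
  also have "\<dots> = size_series (\<lambda>b. \<Sum>t\<le>s. b t) ?W"
    by (simp add: size_series_finite finite_walks power_sum)
  also have "\<dots> = fps_X ^ 0 * size_series (\<lambda>a. sum a {1..Suc s}) A"
  proof (rule size_series_bij)
    show "bij_betw (\<lambda>a. \<lambda>t\<in>{..s}. a (Suc t)) A ?W"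
    proof (rule bij_betw_byWitness[where f' = "\<lambda>b. \<lambda>i\<in>{1..Suc s}. b (i - 1)"])
      show "\<forall>a\<in>A. (\<lambda>i\<in>{1..Suc s}. (\<lambda>t\<in>{..s}. a (Suc t)) (i - 1)) = a"
        by (auto simp: A_def zigzags_def PiE_iff extensional_def fun_eq_iff)
      show "\<forall>b\<in>?W. (\<lambda>t\<in>{..s}. (\<lambda>i\<in>{1..Suc s}. b (i - 1)) (Suc t)) = b"
        by (auto simp: walks_def PiE_iff extensional_def fun_eq_iff)
      show "(\<lambda>a. \<lambda>t\<in>{..s}. a (Suc t)) ` A \<subseteq> ?W"
      proof (intro image_subsetI)
        fix a assume a: "a \<in> A"
        have "zigzag_step t (a (Suc t)) (a (Suc (Suc t)))" if "t < s" for t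
        proof -
          have "Suc t \<in> {1..<Suc s}" using that by simp
          then have "if odd (Suc t) then a (Suc (Suc t)) \<le> a (Suc t) else a (Suc t) \<le> a (Suc (Suc t))"
            using a unfolding A_def zigzags_def by blast
          then show ?thesis by (simp add: zigzag_step_def)
        qed
        then show "(\<lambda>t\<in>{..s}. a (Suc t)) \<in> ?W"
          using a by (simp add: walks_def restrict_PiE_iff A_def)
      qed
      show "(\<lambda>b. \<lambda>i\<in>{1..Suc s}. b (i - 1)) ` ?W \<subseteq> A"
      proof (intro image_subsetI)
        fix b assume b: "b \<in> ?W"
        have "if odd i then b i \<le> b (i - 1) else b (i - 1) \<le> b i" if i: "i \<in> {1..<Suc s}" for i
        proof -
          obtain t where t: "i = Suc t" "t < s" using i by (cases i) auto
          then have "zigzag_step t (b t) (b (Suc t))" using b by (simp add: walks_def)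
          then show ?thesis using t by (simp add: zigzag_step_def)
        qed
        moreover have "b (i - 1) \<le> M" if "i \<in> {1..Suc s}" for i
          using b that by (auto simp: walks_def PiE_iff)
        ultimately show "(\<lambda>i\<in>{1..Suc s}. b (i - 1)) \<in> A"
          by (auto simp: A_def zigzags_def simp del: One_nat_def)
      qed
    qed
    fix a
    have "(\<Sum>t\<le>s. (\<lambda>t\<in>{..s}. a (Suc t)) t) = (\<Sum>t\<le>s. a (Suc t))" by (rule sum.cong) auto
    also have "\<dots> = sum a {1..Suc s}"
      by (rule sum.reindex_bij_witness[where i = "\<lambda>i. i - 1" and j = Suc]) auto
    finally show "(\<Sum>t\<le>s. (\<lambda>t\<in>{..s}. a (Suc t)) t) = sum a {1..Suc s} + 0" by simp
  qed
  finally have "zigzag_total M (\<lambda>y. fps_X ^ y :: rat fps) s $ N =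
      of_nat (card {a \<in> A. sum a {1..Suc s} = N})"
    by (simp only: size_series_nth power_0 mult_1_left)
  moreover have "{a \<in> A. sum a {1..Suc s} = N} = {a \<in> zigzags (Suc s). sum a {1..Suc s} = N}"
  proof -
    have "a i \<le> M" if "sum a {1..Suc s} = N" "i \<in> {1..Suc s}" for a :: "nat \<Rightarrow> nat" and i
      using member_le_sum[of i "{1..Suc s}" a] that assms by simp
    then show ?thesis by (auto simp only: A_def)
  qed
  ultimately show ?thesis by (simp add: size_series_nth)
qed

section \<open>The strips of a skew staircase\<close>

lemma young_diagram_staircase: "young_diagram (staircase N) = {(i, j). i + j + 2 \<le> N}"
  by (auto simp: young_diagram_def staircase_def rev_nth)

lemma skew_staircase:
  "skew_shape (staircase (n + 2 * k)) (staircase n) = {(i, j). i + j + 2 \<le> n + 2 * k \<and> n \<le> i + j + 1}"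
  by (auto simp: skew_shape_def young_diagram_staircase)

definition adjacent_increasing :: "(nat \<times> nat) set \<Rightarrow> (nat \<times> nat \<Rightarrow> nat) \<Rightarrow> bool" where
  "adjacent_increasing S p \<longleftrightarrow>
     (\<forall>i j. (i, j) \<in> S \<longrightarrow> (i, Suc j) \<in> S \<longrightarrow> p (i, j) \<le> p (i, Suc j)) \<and>
     (\<forall>i j. (i, j) \<in> S \<longrightarrow> (Suc i, j) \<in> S \<longrightarrow> p (i, j) \<le> p (Suc i, j))"

lemma RPP_iff_adjacent_increasing:
  assumes row: "\<And>i j j' l. (i, j) \<in> S \<Longrightarrow> (i, j') \<in> S \<Longrightarrow> j \<le> l \<Longrightarrow> l \<le> j' \<Longrightarrow> (i, l) \<in> S"
    and col: "\<And>i i' j l. (i, j) \<in> S \<Longrightarrow> (i', j) \<in> S \<Longrightarrow> i \<le> l \<Longrightarrow> l \<le> i' \<Longrightarrow> (l, j) \<in> S"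
  shows "p \<in> RPP S \<longleftrightarrow> p \<in> S \<rightarrow>\<^sub>E UNIV \<and> adjacent_increasing S p"
proof
  assume p: "p \<in> S \<rightarrow>\<^sub>E UNIV \<and> adjacent_increasing S p"
  have "p (i, j) \<le> p (i, j')" if "j \<le> j'" "(i, j) \<in> S" "(i, j') \<in> S" for i j j'
    using that
  proof (induction rule: dec_induct)
    case (step l)
    then have l: "(i, l) \<in> S" using row[of i j "Suc l" l] by simp
    then have "p (i, l) \<le> p (i, Suc l)" using p step by (simp add: adjacent_increasing_def)
    then show ?case using step l by simp
  qed simp
  moreover have "p (i, j) \<le> p (i', j)" if "i \<le> i'" "(i, j) \<in> S" "(i', j) \<in> S" for i i' j
    using that
  proof (induction rule: dec_induct)
    case (step l)
    then have l: "(l, j) \<in> S" using col[of i j "Suc l" l] by simp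
    then have "p (l, j) \<le> p (Suc l, j)" using p step by (simp add: adjacent_increasing_def)
    then show ?case using step l by simp
  qed simp
  ultimately show "p \<in> RPP S" using p by (simp add: RPP_def)
qed (auto simp: RPP_def adjacent_increasing_def)

context strips
begin

definition shape :: "(nat \<times> nat) set" where
  "shape = skew_shape (staircase (n + 2 * k)) (staircase n)"

text \<open>Cells are addressed by time \<open>t\<close> and strip \<open>r\<close>: time is the content \<open>j - i\<close>, shifted to start at
  \<open>0\<close>, and strip \<open>r\<close> consists of the antidiagonals \<open>i + j = n + 2 r - 1\<close> (odd times) and
  \<open>i + j = n + 2 r\<close> (even times).\<close>

definition cell :: "nat \<Rightarrow> nat \<Rightarrow> nat \<times> nat" where
  "cell t r = (n + r + k - 1 - (t + 1) div 2, r + t div 2 + 1 - k)"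

definition coord :: "nat \<times> nat \<Rightarrow> nat \<times> nat" where
  "coord = (\<lambda>(i, j). (j + n + 2 * k - 2 - i, (i + j + 1 - n) div 2))"

lemma shape_iff: "(i, j) \<in> shape \<longleftrightarrow> i + j + 2 \<le> n + 2 * k \<and> n \<le> i + j + 1"
  by (simp add: shape_def skew_staircase)

lemma finite_shape: "finite shape"
  by (simp add: shape_def finite_skew_shape)

lemma alive_le_final: "r \<in> alive t \<Longrightarrow> t \<le> final"
  by (auto simp: alive_def final_def)

text \<open>The subtractions and divisions in \<open>cell\<close> amount to these two linear equations, content and
  antidiagonal.\<close>

lemma cell_eq_iff:
  assumes "r \<in> alive t"
  shows "cell t r = (i, j) \<longleftrightarrow> j + n + 2 * k = t + i + 2 \<and> i + j + t mod 2 = n + 2 * r"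
proof -
  define h e where "h = t div 2" and "e = t mod 2"
  have t: "t = 2 * h + e" "e < 2" "(t + 1) div 2 = h + e" unfolding h_def e_def by presburger+
  have "2 * k \<le> 2 * (h + r + 1) + e" "2 * (h + 1) + e \<le> 2 * (n + k + r)"
    using assms by (simp_all add: alive_def t(1))
  moreover have "e = 0 \<or> e = 1" using t(2) by auto
  ultimately have "k \<le> h + r + 1" "h + e + 1 \<le> n + k + r"
    by (elim disjE; simp)+
  then have "cell t r = (i, j) \<longleftrightarrow> i + h + e + 1 = n + r + k \<and> j + k = r + h + 1"
    unfolding cell_def t(3) h_def[symmetric] prod.inject by arith
  also have "\<dots> \<longleftrightarrow> j + n + 2 * k = t + i + 2 \<and> i + j + e = n + 2 * r"
    unfolding t(1) by arith
  finally show ?thesis by (simp add: e_def)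
qed

lemma coord_eq_iff:
  assumes "(i, j) \<in> shape"
  shows "coord (i, j) = (t, r) \<longleftrightarrow> j + n + 2 * k = t + i + 2 \<and> i + j + t mod 2 = n + 2 * r"
proof -
  have sh: "i + j + 2 \<le> n + 2 * k" "n \<le> i + j + 1" using assms by (simp_all add: shape_iff)
  define u where "u = i + j + 1 - n"
  have u: "i + j + 1 = n + u" using sh by (simp add: u_def)
  have t: "j + n + 2 * k - 2 - i = t \<longleftrightarrow> j + n + 2 * k = t + i + 2" using sh by arith
  have "i + j + t mod 2 = n + 2 * r \<longleftrightarrow> u div 2 = r" if "j + n + 2 * k = t + i + 2"
  proof -
    have "t + 2 * i + 3 = 2 * n + u + 2 * k" using that u by linarith
    then have "t mod 2 = (u + 1) mod 2" by presburger
    moreover have "u div 2 = r \<longleftrightarrow> u + (u + 1) mod 2 = 2 * r + 1" by presburger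
    ultimately show ?thesis using u by linarith
  qed
  then show ?thesis unfolding coord_def prod.case prod.inject t u_def[symmetric] by blast
qed

lemma coord_alive:
  assumes "c \<in> shape" "coord c = (t, r)"
  shows "r \<in> alive t" "t \<le> final" "cell t r = c"
proof -
  obtain i j where c: "c = (i, j)" by (cases c)
  have *: "j + n + 2 * k = t + i + 2" "i + j + t mod 2 = n + 2 * r"
    using coord_eq_iff assms c by auto
  have sh: "i + j + 2 \<le> n + 2 * k" using assms(1) c by (simp add: shape_iff)
  obtain e where e: "t mod 2 = e" "e \<le> 1" by (cases "even t") auto
  show "r \<in> alive t"
    unfolding alive_def mem_Collect_eq
  proof (intro conjI)
    show "r < k" using *(2) sh e by linarith
    show "2 * k \<le> t + 2 * r + 2" using * unfolding e(1) by linarith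
    show "t + 2 \<le> 2 * (n + k + r)" using * unfolding e(1) by simp
  qed
  then show "t \<le> final" "cell t r = c" using * c by (simp_all add: cell_eq_iff alive_le_final)
qed

lemma coord_in_alive:
  assumes "c \<in> shape"
  shows "snd (coord c) \<in> alive (fst (coord c))" "fst (coord c) \<le> final"
    "cell (fst (coord c)) (snd (coord c)) = c"
  using coord_alive[OF assms prod.collapse[symmetric]] by blast+

lemma cell_in_shape:
  assumes "r \<in> alive t"
  shows "cell t r \<in> shape" "coord (cell t r) = (t, r)"
proof -
  obtain i j where c: "cell t r = (i, j)" by (cases "cell t r")
  have *: "j + n + 2 * k = t + i + 2" "i + j + t mod 2 = n + 2 * r"
    using cell_eq_iff[OF assms] c by auto
  have "t mod 2 < 2" by simp
  then show "cell t r \<in> shape"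
    using * assms unfolding c shape_iff alive_def mem_Collect_eq by linarith
  then show "coord (cell t r) = (t, r)" using * c by (simp add: coord_eq_iff)
qed

lemma bij_cell: "bij_betw (\<lambda>(t, r). cell t r) (Sigma {..final} alive) shape"
proof (rule bij_betw_byWitness[where f' = coord])
  show "coord ` shape \<subseteq> Sigma {..final} alive"
  proof (intro image_subsetI)
    fix c assume "c \<in> shape"
    then show "coord c \<in> Sigma {..final} alive"
      using coord_in_alive[of c] by (cases "coord c") simp
  qed
qed (auto simp: cell_in_shape coord_in_alive split_def)

lemma right_neighbour_coord:
  assumes "(i, j) \<in> shape" "(i, Suc j) \<in> shape" "coord (i, j) = (t, r)"
  shows "coord (i, Suc j) = (Suc t, if even t then Suc r else r)"
  using assms(3) unfolding coord_eq_iff[OF assms(1)] coord_eq_iff[OF assms(2)]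
  by (cases "even t") (simp_all add: mod_Suc even_iff_mod_2_eq_zero odd_iff_mod_2_eq_one)

lemma lower_neighbour_coord:
  assumes "(i, j) \<in> shape" "(Suc i, j) \<in> shape" "coord (Suc i, j) = (t, r)"
  shows "coord (i, j) = (Suc t, if even t then r else r - 1) \<and> (odd t \<longrightarrow> 0 < r)"
proof -
  have *: "j + n + 2 * k = t + Suc i + 2" "Suc i + j + t mod 2 = n + 2 * r"
    using assms(3) coord_eq_iff[OF assms(2)] by auto
  have "0 < r" if "odd t"
    using * assms(1) that by (cases r) (auto simp: shape_iff odd_iff_mod_2_eq_one)
  then show ?thesis
    using * unfolding coord_eq_iff[OF assms(1)]
    by (cases "even t") (auto simp: coord_eq_iff[OF assms(1)] mod_Suc even_iff_mod_2_eq_zero odd_iff_mod_2_eq_one)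
qed

definition size_shift :: nat where
  "size_shift = (\<Sum>t\<le>final. \<Sum>r\<in>alive t. r)"

text \<open>This makes it possible to undo the shift without leaving the natural numbers. An odd time of strip
  \<open>r + 1\<close> is adjacent to an even time at which strip \<open>r\<close> is present, and interlacing is strict there; an
  even time of strip \<open>r + 1\<close> is adjacent to an odd time of the same strip, whose entry is at most as large.\<close>

lemma strip_index_le_walk:
  assumes b: "b \<in> walks (configs M) interlace final" and r: "r \<in> alive t"
  shows "r \<le> b t r"
  using r
proof (induction r arbitrary: t)
  case (Suc r)
  have step: "interlace t (b t) (b (Suc t))" if "t < final" for t
    using b that by (simp add: walks_def)
  have inner: "Suc r \<le> b t (Suc r)" if t: "odd t" and alive: "Suc r \<in> alive t" for t
  proof (cases "r \<in> alive (Suc t)")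
    case True
    then have "b (Suc t) r < b t (Suc r)"
      using step[of t] alive_le_final[OF True] t alive by (auto simp: interlace_def)
    then show ?thesis using Suc.IH[OF True] by simp
  next
    case False
    obtain s where s: "t = Suc s" "even s" using t by (cases t) auto
    have rs: "r \<in> alive s"
    proof -
      obtain h where h: "s = 2 * h" using s(2) by (rule evenE)
      have a: "r < k" "2 * k \<le> Suc (2 * (h + r + 2))" "Suc (2 * (h + 1)) \<le> 2 * (n + k + r + 1)"
        using alive by (simp_all add: alive_def s(1) h)
      then have "k \<le> h + r + 2" "h + 2 \<le> n + k + r + 1" by presburger+
      moreover from this have "n + k + r < h + 2" using False a by (auto simp: alive_def s(1) h)
      ultimately show ?thesis using a n by (simp add: alive_def h)
    qed
    then have "b s r < b t (Suc r)"
      using step[of s] alive_le_final[OF alive] s alive by (auto simp: interlace_def)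
    then show ?thesis using Suc.IH[OF rs] by simp
  qed
  show ?case
  proof (cases "odd t")
    case True
    then show ?thesis using inner Suc.prems by blast
  next
    case even: False
    show ?thesis
    proof (cases "Suc r \<in> alive (Suc t)")
      case True
      then have "b (Suc t) (Suc r) \<le> b t (Suc r)"
        using step[of t] alive_le_final[OF True] even Suc.prems by (auto simp: interlace_def)
      then show ?thesis using inner[OF _ True] even by simp
    next
      case False
      then have "0 < t" using Suc.prems n by (cases t) (auto simp: alive_def)
      then obtain s where s: "t = Suc s" "odd s" using even by (cases t) auto
      have rs: "Suc r \<in> alive s" using False Suc.prems s n unfolding alive_def mem_Collect_eq
        by (auto elim!: oddE)
      then have "b s (Suc r) \<le> b t (Suc r)"
        using step[of s] alive_le_final[OF Suc.prems] s Suc.prems by (auto simp: interlace_def)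
      then show ?thesis using inner[OF s(2) rs] by simp
    qed
  qed
qed simp

lemma RPP_shape_iff: "p \<in> RPP shape \<longleftrightarrow> p \<in> shape \<rightarrow>\<^sub>E UNIV \<and> adjacent_increasing shape p"
  by (rule RPP_iff_adjacent_increasing) (auto simp: shape_iff)

text \<open>The bound is imposed on the shifted entries, which are the entries of the configurations.\<close>

definition bounded_RPP :: "nat \<Rightarrow> (nat \<times> nat \<Rightarrow> nat) set" where
  "bounded_RPP M = {p \<in> RPP shape. \<forall>t. \<forall>r\<in>alive t. p (cell t r) + r \<le> M}"

lemma cell_right:
  assumes "r \<in> alive t" "r' \<in> alive (Suc t)" "r' = (if even t then Suc r else r)" "cell t r = (i, j)"
  shows "cell (Suc t) r' = (i, Suc j)"
  using cell_eq_iff[OF assms(1), of i j] assms(3,4) unfolding cell_eq_iff[OF assms(2)]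
  by (cases "even t") (auto simp: mod_Suc even_iff_mod_2_eq_zero odd_iff_mod_2_eq_one)

lemma cell_below:
  assumes "r' \<in> alive t" "r \<in> alive (Suc t)" "r' = (if even t then r else Suc r)" "cell (Suc t) r = (i, j)"
  shows "cell t r' = (Suc i, j)"
  using cell_eq_iff[OF assms(2), of i j] assms(3,4) unfolding cell_eq_iff[OF assms(1)]
  by (cases "even t") (auto simp: mod_Suc even_iff_mod_2_eq_zero odd_iff_mod_2_eq_one)

text \<open>A right neighbour lies one time later and a lower neighbour one time earlier; under the shift by the
  strip index the weak inequalities within a strip stay weak and those between strips become strict.
  So increasing rows and columns translate into interlacing.\<close>

lemma bij_bounded_RPP_walks:
  "bij_betw (\<lambda>p. \<lambda>t\<in>{..final}. \<lambda>r\<in>alive t. p (cell t r) + r)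
     (bounded_RPP M) (walks (configs M) interlace final)"
    (is "bij_betw ?f _ ?W")
proof (rule bij_betw_byWitness)
  let ?g = "\<lambda>b. \<lambda>c\<in>shape. b (fst (coord c)) (snd (coord c)) - snd (coord c)"
  show "\<forall>p\<in>bounded_RPP M. ?g (?f p) = p"
  proof
    fix p assume "p \<in> bounded_RPP M"
    then have "p \<in> extensional shape" by (auto simp: bounded_RPP_def RPP_def PiE_iff)
    moreover have "?g (?f p) c = p c" if "c \<in> shape" for c
      using that coord_alive[OF that, of "fst (coord c)" "snd (coord c)"] by simp
    ultimately show "?g (?f p) = p" by (intro extensionalityI[of _ shape]) auto
  qed
  show "\<forall>b\<in>?W. ?f (?g b) = b"
  proof
    fix b assume b: "b \<in> ?W"
    then have bE: "b \<in> PiE {..final} (configs M)" by (simp add: walks_def)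
    show "?f (?g b) = b"
    proof (rule extensionalityI[of _ "{..final}"])
      fix t assume t: "t \<in> {..final}"
      then have "b t \<in> extensional (alive t)" using bE by (auto simp: configs_def PiE_iff)
      moreover have "?f (?g b) t r = b t r" if "r \<in> alive t" for r
        using that t strip_index_le_walk[OF b that] cell_in_shape[OF that] by simp
      ultimately show "?f (?g b) t = b t"
        using t by (intro extensionalityI[of _ "alive t"]) auto
    qed (use bE in \<open>auto simp: PiE_iff\<close>)
  qed
  show "?f ` bounded_RPP M \<subseteq> ?W"
  proof (intro image_subsetI)
    fix p assume p: "p \<in> bounded_RPP M"
    then have adj: "adjacent_increasing shape p" by (simp add: bounded_RPP_def RPP_shape_iff)
    have right: "p (cell t r) \<le> p (cell (Suc t) r')"
      if "r \<in> alive t" "r' \<in> alive (Suc t)" "r' = (if even t then Suc r else r)" for t r r'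
    proof -
      obtain i j where ij: "cell t r = (i, j)" by (cases "cell t r")
      then show ?thesis
        using adj cell_right[OF that ij] cell_in_shape(1)[OF that(1)] cell_in_shape(1)[OF that(2)]
        by (simp add: adjacent_increasing_def)
    qed
    have below: "p (cell (Suc t) r) \<le> p (cell t r')"
      if "r' \<in> alive t" "r \<in> alive (Suc t)" "r' = (if even t then r else Suc r)" for t r r'
    proof -
      obtain i j where ij: "cell (Suc t) r = (i, j)" by (cases "cell (Suc t) r")
      then show ?thesis
        using adj cell_below[OF that ij] cell_in_shape(1)[OF that(1)] cell_in_shape(1)[OF that(2)]
        by (simp add: adjacent_increasing_def)
    qed
    have "interlace t (?f p t) (?f p (Suc t))" if "t < final" for t
      using that right[of _ t] below[of _ t]
      by (cases "even t") (auto simp: interlace_def less_Suc_eq_le add_le_mono)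
    moreover have "?f p \<in> PiE {..final} (configs M)"
      using p by (auto simp: bounded_RPP_def configs_def)
    ultimately show "?f p \<in> ?W" by (simp add: walks_def)
  qed
  show "?g ` ?W \<subseteq> bounded_RPP M"
  proof (intro image_subsetI)
    fix b assume b: "b \<in> ?W"
    then have bE: "b \<in> PiE {..final} (configs M)" by (simp add: walks_def)
    have step: "interlace t (b t) (b (Suc t))" if "t < final" for t
      using b that by (simp add: walks_def)
    have "?g b (i, j) \<le> ?g b (i, Suc j)" if c: "(i, j) \<in> shape" "(i, Suc j) \<in> shape" for i j
    proof -
      obtain t r where tr: "coord (i, j) = (t, r)" by (cases "coord (i, j)")
      note tr' = right_neighbour_coord[OF c tr]
      have "interlace t (b t) (b (Suc t))"
        using step coord_alive(2)[OF c(2) tr'] by simp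
      then show ?thesis
        using c tr tr' coord_alive(1)[OF c(1) tr] coord_alive(1)[OF c(2) tr']
        by (cases "even t") (force simp: interlace_def)+
    qed
    moreover have "?g b (i, j) \<le> ?g b (Suc i, j)" if c: "(i, j) \<in> shape" "(Suc i, j) \<in> shape" for i j
    proof -
      obtain t r where tr: "coord (Suc i, j) = (t, r)" by (cases "coord (Suc i, j)")
      have tr': "coord (i, j) = (Suc t, if even t then r else r - 1)" and r: "odd t \<Longrightarrow> r = Suc (r - 1)"
        using lower_neighbour_coord[OF c tr] by auto
      have step: "interlace t (b t) (b (Suc t))"
        using step coord_alive(2)[OF c(1) tr'] by simp
      show ?thesis
      proof (cases "even t")
        case True
        then have "b (Suc t) r \<le> b t r"
          using step coord_alive(1)[OF c(2) tr] coord_alive(1)[OF c(1) tr'] by (auto simp: interlace_def)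
        then show ?thesis using c tr tr' True by simp
      next
        case False
        then have "b (Suc t) (r - 1) < b t r"
          using step coord_alive(1)[OF c(2) tr] coord_alive(1)[OF c(1) tr'] r
          unfolding interlace_def by (metis (no_types, lifting))
        then show ?thesis using c tr tr' False r by simp
      qed
    qed
    ultimately have "?g b \<in> RPP shape"
      by (simp add: RPP_shape_iff adjacent_increasing_def)
    moreover have "?g b (cell t r) + r \<le> M" if "r \<in> alive t" for t r
    proof -
      have "b t r \<le> M" using bE alive_le_final[OF that] that by (auto simp: configs_def PiE_iff)
      then show ?thesis using that strip_index_le_walk[OF b that] cell_in_shape[OF that] by simp
    qed
    ultimately show "?g b \<in> bounded_RPP M" by (simp add: bounded_RPP_def)
  qed
qed

lemma sum_shape: "(\<Sum>c\<in>shape. p c) = (\<Sum>t\<le>final. \<Sum>r\<in>alive t. p (cell t r))"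
proof -
  have "(\<Sum>c\<in>shape. p c) = (\<Sum>x\<in>Sigma {..final} alive. p ((\<lambda>(t, r). cell t r) x))"
    by (rule sum.reindex_bij_betw[OF bij_cell, symmetric])
  also have "\<dots> = (\<Sum>t\<le>final. \<Sum>r\<in>alive t. p (cell t r))"
    by (subst sum.Sigma) (auto simp: finite_alive split_def)
  finally show ?thesis .
qed

end

section \<open>The determinant formula\<close>

context strips
begin

lemma shifted_RPP_series:
  "fps_X ^ size_shift * RPP_series shape =
    fdet k (\<lambda>j i. size_series (\<lambda>a. sum a {1..2 * (n + i + j) + 1}) (zigzags (2 * (n + i + j) + 1)))"
proof (rule fps_ext)
  fix N
  let ?R = "\<lambda>j i. size_series (\<lambda>a. sum a {1..2 * (n + i + j) + 1}) (zigzags (2 * (n + i + j) + 1))"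
  let ?wt = "\<lambda>p. \<Sum>c\<in>shape. p c"
  \<comment> \<open>entries of a filling of size \<open>N\<close> are at most \<open>N\<close>, and the shift adds less than \<open>k\<close>\<close>
  define M where "M = N + k"
  let ?W = "walks (configs M) interlace final"
  interpret weighted_strips n k M "\<lambda>y. fps_X ^ y :: rat fps" ..
  have "fdet k ?R $ N = fdet k (\<lambda>j i. zigzag_total M (\<lambda>y. fps_X ^ y) (2 * (n + i + j))) $ N"
  proof (rule fdet_nth_cong)
    fix j i l assume "l \<le> N"
    then show "?R j i $ l = zigzag_total M (\<lambda>y. fps_X ^ y) (2 * (n + i + j)) $ l"
      using zigzag_total_nth[of l M "2 * (n + i + j)"] by (simp add: M_def)
  qed
  also have "fdet k (\<lambda>j i. zigzag_total M (\<lambda>y. fps_X ^ y) (2 * (n + i + j))) =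
      (\<Sum>b\<in>?W. \<Prod>t\<le>final. \<Prod>r\<in>alive t. fps_X ^ b t r :: rat fps)"
    by (rule sum_walks_eq_fdet[symmetric])
  also have "\<dots> = size_series (\<lambda>b. \<Sum>t\<le>final. \<Sum>r\<in>alive t. b t r) ?W"
    by (simp add: size_series_finite finite_walks finite_configs power_sum)
  also have "\<dots> = fps_X ^ size_shift * size_series ?wt (bounded_RPP M)"
  proof (rule size_series_bij[OF bij_bounded_RPP_walks])
    fix p :: "nat \<times> nat \<Rightarrow> nat"
    have "(\<Sum>t\<le>final. \<Sum>r\<in>alive t. (\<lambda>t\<in>{..final}. \<lambda>r\<in>alive t. p (cell t r) + r) t r) =
        (\<Sum>t\<le>final. \<Sum>r\<in>alive t. p (cell t r) + r)"
      by (intro sum.cong) auto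
    then show "(\<Sum>t\<le>final. \<Sum>r\<in>alive t. (\<lambda>t\<in>{..final}. \<lambda>r\<in>alive t. p (cell t r) + r) t r) = ?wt p + size_shift"
      by (simp add: sum_shape size_shift_def sum.distrib)
  qed
  also have "\<dots> $ N = (fps_X ^ size_shift * RPP_series shape) $ N"
  proof -
    have "size_series ?wt (bounded_RPP M) $ l = RPP_series shape $ l" if "l \<le> N" for l
    proof -
      have "p (cell t r) + r \<le> M" if "?wt p = l" "r \<in> alive t" for p :: "nat \<times> nat \<Rightarrow> nat" and t r
      proof -
        have "p (cell t r) \<le> l"
          using member_le_sum[OF cell_in_shape(1)[OF that(2)], of p] finite_shape that(1) by simp
        moreover have "r < k" using that(2) by (simp add: alive_def)
        ultimately show ?thesis using \<open>l \<le> N\<close> by (simp add: M_def)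
      qed
      then have "{p \<in> bounded_RPP M. ?wt p = l} = {p \<in> RPP shape. ?wt p = l}"
        by (auto simp: bounded_RPP_def)
      then show ?thesis by (simp add: size_series_nth RPP_series_def)
    qed
    then show ?thesis by (simp add: fps_X_power_mult_nth)
  qed
  finally show "(fps_X ^ size_shift * RPP_series shape) $ N = fdet k ?R $ N" by simp
qed

text \<open>Strip \<open>r\<close> has \<open>2 n + 4 r + 1\<close> cells, each of which was raised by \<open>r\<close>.\<close>

lemma six_times_size_shift:
  "6 * int size_shift = int k * (int k - 1) * (6 * int n + 8 * int k - 1)"
proof -
  have "size_shift = (\<Sum>t\<le>final. \<Sum>r<k. if r \<in> alive t then r else 0)"
    unfolding size_shift_def
  proof (rule sum.cong[OF refl])
    fix t
    have "alive t = {r \<in> {..<k}. r \<in> alive t}" using alive_subset by auto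
    then have "\<Sum> (alive t) = \<Sum> {r \<in> {..<k}. r \<in> alive t}" by simp
    also have "\<dots> = (\<Sum>r<k. if r \<in> alive t then r else 0)" by (rule sum.inter_filter) simp
    finally show "\<Sum> (alive t) = (\<Sum>r<k. if r \<in> alive t then r else 0)" .
  qed
  also have "\<dots> = (\<Sum>r<k. \<Sum>t\<le>final. if r \<in> alive t then r else 0)" by (rule sum.swap)
  also have "\<dots> = (\<Sum>r<k. r * (2 * n + 4 * r + 1))"
  proof (rule sum.cong[OF refl])
    fix r assume r: "r \<in> {..<k}"
    have "{t \<in> {..final}. r \<in> alive t} = {2 * k - 2 * r - 2 .. 2 * (n + k + r) - 2}"
      using r n k by (auto simp: alive_def final_def)
    then have "card {t \<in> {..final}. r \<in> alive t} = 2 * n + 4 * r + 1" using r n by auto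
    then show "(\<Sum>t\<le>final. if r \<in> alive t then r else 0) = r * (2 * n + 4 * r + 1)"
      by (subst sum.inter_filter[symmetric]) auto
  qed
  also have "6 * int (\<Sum>r<k. r * (2 * n + 4 * r + 1)) = int k * (int k - 1) * (6 * int n + 8 * int k - 1)" for k
    by (induction k) (simp_all add: algebra_simps)
  finally show ?thesis .
qed

end

lemma comm_ring_hom_fps_to_fls: "comm_ring_hom (fps_to_fls :: 'a::comm_ring_1 fps \<Rightarrow> 'a fls)"
  by unfold_locales (simp_all add: fls_times_fps_to_fls)

theorem theorem1p2:
  fixes n k :: nat
  assumes "n \<ge> 1" and "k \<ge> 1"
  shows "fps_to_fls (RPP_series (skew_shape (staircase (n + 2 * k)) (staircase n))) =
    fls_X powi (- ((int k * (int k - 1) * (6 * int n + 8 * int k - 1)) div 6)) *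
    det (mat k k (\<lambda>(i, j).
      let m = 2 * n + 2 * Suc i + 2 * Suc j - 3
      in q_Euler m fls_X / q_pochhammer fls_X fls_X m))"
proof -
  interpret strips n k using assms by unfold_locales auto
  interpret hom: comm_ring_hom "fps_to_fls :: rat fps \<Rightarrow> rat fls" by (rule comm_ring_hom_fps_to_fls)
  let ?Z = "\<lambda>m. size_series (\<lambda>a. sum a {1..m}) (zigzags m)"
  let ?A = "mat k k (\<lambda>(j, i). ?Z (2 * (n + i + j) + 1))"
  have entry: "q_Euler m fls_X / q_pochhammer fls_X fls_X m = fps_to_fls (?Z m)" if "odd m" for m
  proof -
    have "q_Euler m fls_X = fps_to_fls (q_Euler m fps_X :: rat fps)"
      by (simp add: q_Euler_def hom.hom_sum hom.hom_power)
    moreover have poch: "q_pochhammer fls_X fls_X m = fps_to_fls (q_pochhammer fps_X fps_X m :: rat fps)"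
      by (simp add: q_pochhammer_def hom.hom_prod hom.hom_power hom.hom_mult)
    moreover have "q_pochhammer fps_X fps_X m \<noteq> (0 :: rat fps)"
      using size_series_decreasing_seqs[of m] by auto
    ultimately show ?thesis
      using size_series_zigzags[OF that] by (simp add: divide_eq_eq hom.hom_mult[symmetric])
  qed
  have "mat k k (\<lambda>(i, j). let m = 2 * n + 2 * Suc i + 2 * Suc j - 3
      in q_Euler m fls_X / q_pochhammer fls_X fls_X m) = map_mat fps_to_fls ?A"
  proof (rule eq_matI)
    fix i j assume ij: "i < dim_row (map_mat fps_to_fls ?A)" "j < dim_col (map_mat fps_to_fls ?A)"
    have "2 * n + 2 * Suc i + 2 * Suc j - 3 = 2 * (n + j + i) + 1" by simp
    then have "(let m = 2 * n + 2 * Suc i + 2 * Suc j - 3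
        in q_Euler m fls_X / q_pochhammer fls_X fls_X m) = fps_to_fls (?Z (2 * (n + j + i) + 1))"
      using entry[of "2 * (n + j + i) + 1"] by (simp only: Let_def) simp
    then show "mat k k (\<lambda>(i, j). let m = 2 * n + 2 * Suc i + 2 * Suc j - 3
      in q_Euler m fls_X / q_pochhammer fls_X fls_X m) $$ (i, j) = map_mat fps_to_fls ?A $$ (i, j)"
      using ij by simp
  qed auto
  then have "det (mat k k (\<lambda>(i, j). let m = 2 * n + 2 * Suc i + 2 * Suc j - 3
      in q_Euler m fls_X / q_pochhammer fls_X fls_X m)) = fps_to_fls (det ?A)"
    by (simp only: hom.hom_det)
  also have "det ?A = fps_X ^ size_shift * RPP_series shape"
    by (rule shifted_RPP_series[symmetric])
  also have "fps_to_fls (fps_X ^ size_shift * RPP_series shape) =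
      fls_X ^ size_shift * fps_to_fls (RPP_series shape)"
    by (simp add: hom.hom_mult hom.hom_power)
  finally have det: "det (mat k k (\<lambda>(i, j). let m = 2 * n + 2 * Suc i + 2 * Suc j - 3
      in q_Euler m fls_X / q_pochhammer fls_X fls_X m)) =
      fls_X ^ size_shift * fps_to_fls (RPP_series shape)" .
  have "(int k * (int k - 1) * (6 * int n + 8 * int k - 1)) div 6 = int size_shift"
    using six_times_size_shift by simp
  then show ?thesis
    unfolding det by (simp add: shape_def power_int_minus)
qed

end
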